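(* Let $r,s>0$ be integers and $\mathbf d=(d_1,d_2,d_3)$ nonnegative integers. Let $$N=\dim V_A(\mathbf d)+\dim V_B(\mathbf d)+\dim V_\Lambda(\mathbf d),$$ and let $\boldsymbol\omega\in\mathbb{Z}_{>0}^N$ be the vector whose entry at the coordinate indexing the coefficient of $u^iv^j$ (in $A$, $B$ or $\Lambda$) equals $1+i+j$. Let $\mathbb{G}_m$ act on $V_A(\mathbf d)\oplus V_B(\mathbf d)\oplus V_\Lambda(\mathbf d)$ by multiplying every coefficient of $u^iv^j$ by $t^{1+i+j}$. Then this action identifies $$\bigl(V_A(\mathbf d)\oplus V_B(\mathbf d)\oplus V_\Lambda(\mathbf d)\bigr)\setminus\{0\}\,\big/\,\mathbb{G}_m=\mathbb{WP}(\boldsymbol\omega),$$ a weighted projective space, well-formed when $d_1\ge2$ and $d_3\ge1$, and the equation $\mu_{ij}=0$ is homogeneous for it of weighted degree $5+i+j$. The graded Keller counterexamples of bounded degree are therefore parametrised by a locally closed subvariety $\mathcal{W}_{r,s,\mathbf d}\subseteq\mathbb{WP}(\boldsymbol\omega)$ defined over $\mathbb{Z}$, namely the one given by $\mu_{ij}=0$ for $(i,j)\ne(0,0)$ together with the open conditions $\mu_{00}\ne0$ and $\deg\Lambda\ge1$.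
   Context: $V_A=\mathrm{span}\{u^iv^j: ri+sj\ge s\}$, $V_B=\mathrm{span}\{u^iv^j: ri+sj\ge r\}$ inside $\mathbb{C}[u,v]$; $V_A(\mathbf d)$, $V_B(\mathbf d)$ are their subspaces of polynomials of total degree $\le d_1$, $\le d_2$, and $V_\Lambda(\mathbf d)$ is the space of polynomials in $u,v$ of total degree $\le d_3$. With $\{f,g\}=f_ug_v-f_vg_u$, $\mu(A,B,\Lambda)=\Lambda\{B,A\}+sA\{B,\Lambda\}+rB\{\Lambda,A\}=\sum\mu_{ij}u^iv^j$. A triple $(A,B,\Lambda)$ defines the polynomial map $G=(x^{-s}A,x^{-r}B,x\Lambda)$ of $\mathbb{C}^3$, where $u=x^ry$, $v=x^sz$; $G$ has nonzero constant Jacobian determinant iff $\mu(A,B,\Lambda)$ is a nonzero constant. The "graded Keller counterexamples of bounded degree" here are the maps $G$ attached to triples with $A\in V_A(\mathbf d)$, $B\in V_B(\mathbf d)$, $\Lambda\in V_\Lambda(\mathbf d)$, $\deg\Lambda\ge1$ and $\mu(A,B,\Lambda)$ a nonzero constant, and points of $\mathcal W_{r,s,\mathbf d}$ are such triples modulo the stated $\mathbb{G}_m$. A weighted projective space $\mathbb{WP}(\omega_1,\dots,\omega_N)$ is well-formed if any $N-1$ of the weights have greatest common divisor $1$. *)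

theory Defs
  imports "HOL-Analysis.Abstract_Topology" "HOL-Library.Poly_Mapping" "HOL-Library.Product_Plus"
    Complex_Main
begin

section \<open>Polynomials in two variables\<close>

text \<open>The coefficient of \<open>u^i v^j\<close> sits at the key \<open>(i, j)\<close>; multiplication is the
  convolution product that \<open>Poly_Mapping\<close> provides for keys in the additive monoid of pairs.\<close>

type_synonym 'a bpoly = "(nat \<times> nat) \<Rightarrow>\<^sub>0 'a"

abbreviation bmonom :: "nat \<Rightarrow> nat \<Rightarrow> 'a \<Rightarrow> 'a::zero bpoly" where
  "bmonom i j c \<equiv> Poly_Mapping.single (i, j) c"

definition total_degree :: "'a::zero bpoly \<Rightarrow> nat" where
  "total_degree p = Max (insert 0 ((\<lambda>(i, j). i + j) ` Poly_Mapping.keys p))"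

definition du :: "'a::comm_ring_1 bpoly \<Rightarrow> 'a bpoly" where
  "du p = (\<Sum>(i, j)\<in>Poly_Mapping.keys p.
             bmonom (i - 1) j (of_nat i * Poly_Mapping.lookup p (i, j)))"

definition dv :: "'a::comm_ring_1 bpoly \<Rightarrow> 'a bpoly" where
  "dv p = (\<Sum>(i, j)\<in>Poly_Mapping.keys p.
             bmonom i (j - 1) (of_nat j * Poly_Mapping.lookup p (i, j)))"

definition bracket :: "'a::comm_ring_1 bpoly \<Rightarrow> 'a bpoly \<Rightarrow> 'a bpoly" where
  "bracket f g = du f * dv g - dv f * du g"

definition mu :: "nat \<Rightarrow> nat \<Rightarrow> 'a::comm_ring_1 bpoly \<Rightarrow> 'a bpoly \<Rightarrow> 'a bpoly \<Rightarrow> 'a bpoly" where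
  "mu r s A B L = L * bracket B A + of_nat s * A * bracket B L + of_nat r * B * bracket L A"

definition cscale :: "complex \<Rightarrow> complex bpoly \<Rightarrow> complex bpoly" where
  "cscale c p = Poly_Mapping.map ((*) c) p"

lemma lookup_cscale: "Poly_Mapping.lookup (cscale c p) k = c * Poly_Mapping.lookup p k"
  by (simp add: cscale_def Poly_Mapping.map.rep_eq when_def)

interpretation bpoly: vector_space cscale
  by unfold_locales
    (auto intro!: poly_mapping_eqI simp: lookup_cscale lookup_add algebra_simps)

section \<open>The spaces of triples and the action of the multiplicative group\<close>

definition V_A :: "nat \<Rightarrow> nat \<Rightarrow> complex bpoly set" where
  "V_A r s = bpoly.span {bmonom i j 1 | i j. r * i + s * j \<ge> s}"

definition V_B :: "nat \<Rightarrow> nat \<Rightarrow> complex bpoly set" where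
  "V_B r s = bpoly.span {bmonom i j 1 | i j. r * i + s * j \<ge> r}"

definition V_A_deg :: "nat \<Rightarrow> nat \<Rightarrow> nat \<Rightarrow> complex bpoly set" where
  "V_A_deg r s d1 = {p \<in> V_A r s. total_degree p \<le> d1}"

definition V_B_deg :: "nat \<Rightarrow> nat \<Rightarrow> nat \<Rightarrow> complex bpoly set" where
  "V_B_deg r s d2 = {p \<in> V_B r s. total_degree p \<le> d2}"

definition V_L_deg :: "nat \<Rightarrow> complex bpoly set" where
  "V_L_deg d3 = {p. total_degree p \<le> d3}"

type_synonym triple = "complex bpoly \<times> complex bpoly \<times> complex bpoly"

definition triples :: "nat \<Rightarrow> nat \<Rightarrow> nat \<Rightarrow> nat \<Rightarrow> nat \<Rightarrow> triple set" where
  "triples r s d1 d2 d3 = V_A_deg r s d1 \<times> V_B_deg r s d2 \<times> V_L_deg d3"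

definition twist :: "complex \<Rightarrow> complex bpoly \<Rightarrow> complex bpoly" where
  "twist t p = Poly_Mapping.mapp (\<lambda>(i, j) c. t ^ (1 + i + j) * c) p"

definition gm_act :: "complex \<Rightarrow> triple \<Rightarrow> triple" where
  "gm_act t = (\<lambda>(A, B, L). (twist t A, twist t B, twist t L))"

definition gm_orbit :: "triple \<Rightarrow> triple set" where
  "gm_orbit T = {gm_act t T | t. t \<noteq> 0}"

section \<open>Coordinates and weights\<close>

datatype component = In_A | In_B | In_L

text \<open>\<open>(X, i, j)\<close> indexes the coefficient of \<open>u^i v^j\<close> in the polynomial named by \<open>X\<close>.\<close>

type_synonym coord = "component \<times> nat \<times> nat"

definition coords :: "nat \<Rightarrow> nat \<Rightarrow> nat \<Rightarrow> nat \<Rightarrow> nat \<Rightarrow> coord set" where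
  "coords r s d1 d2 d3 =
     {(In_A, i, j) | i j. r * i + s * j \<ge> s \<and> i + j \<le> d1} \<union>
     {(In_B, i, j) | i j. r * i + s * j \<ge> r \<and> i + j \<le> d2} \<union>
     {(In_L, i, j) | i j. i + j \<le> d3}"

definition weight :: "coord \<Rightarrow> nat" where
  "weight = (\<lambda>(X, i, j). 1 + i + j)"

definition coord_vec :: "triple \<Rightarrow> coord \<Rightarrow> complex" where
  "coord_vec = (\<lambda>(A, B, L) (X, ij).
     case X of In_A \<Rightarrow> Poly_Mapping.lookup A ij
             | In_B \<Rightarrow> Poly_Mapping.lookup B ij
             | In_L \<Rightarrow> Poly_Mapping.lookup L ij)"

section \<open>Multivariate polynomials with variables in an index set\<close>

type_synonym ('k, 'a) mpoly = "('k \<Rightarrow>\<^sub>0 nat) \<Rightarrow>\<^sub>0 'a"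

definition mvar :: "'k \<Rightarrow> ('k, 'a::comm_ring_1) mpoly" where
  "mvar k = Poly_Mapping.single (Poly_Mapping.single k 1) 1"

definition polys_in :: "'k set \<Rightarrow> ('k, 'a::comm_ring_1) mpoly set" where
  "polys_in I = {f. \<forall>m\<in>Poly_Mapping.keys f. Poly_Mapping.keys m \<subseteq> I}"

definition mpoly_eval :: "('k, 'a::comm_ring_1) mpoly \<Rightarrow> ('k \<Rightarrow> 'a) \<Rightarrow> 'a" where
  "mpoly_eval f x = (\<Sum>m\<in>Poly_Mapping.keys f. Poly_Mapping.lookup f m *
     (\<Prod>k\<in>Poly_Mapping.keys m. x k ^ Poly_Mapping.lookup m k))"

definition base_change :: "('k, int) mpoly \<Rightarrow> ('k, complex) mpoly" where
  "base_change f = Poly_Mapping.map of_int f"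

definition whomogeneous :: "('k \<Rightarrow> nat) \<Rightarrow> nat \<Rightarrow> ('k, 'a::comm_ring_1) mpoly \<Rightarrow> bool" where
  "whomogeneous w e f \<longleftrightarrow>
     (\<forall>m\<in>Poly_Mapping.keys f. (\<Sum>k\<in>Poly_Mapping.keys m. Poly_Mapping.lookup m k * w k) = e)"

definition whom_polys :: "'k set \<Rightarrow> ('k \<Rightarrow> nat) \<Rightarrow> ('k, 'a::comm_ring_1) mpoly set" where
  "whom_polys I w = {f \<in> polys_in I. \<exists>e. whomogeneous w e f}"

section \<open>Affine space over an index set\<close>

text \<open>Complex varieties are treated as their sets of closed points, with the Zariski topology
  and the predicate saying which complex functions on a given open set are regular. A point of
  the affine space with coordinates indexed by \<open>I\<close> is a function vanishing off \<open>I\<close>.\<close>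

definition affine_space :: "'k set \<Rightarrow> ('k \<Rightarrow> complex) set" where
  "affine_space I = {x. \<forall>k. k \<notin> I \<longrightarrow> x k = 0}"

definition affine_topology :: "'k set \<Rightarrow> ('k \<Rightarrow> complex) topology" where
  "affine_topology I = topology (\<lambda>U. \<exists>S \<subseteq> polys_in I.
     U = affine_space I - {x \<in> affine_space I. \<forall>f\<in>S. mpoly_eval f x = 0})"

section \<open>Weighted projective space\<close>

definition wact :: "('k \<Rightarrow> nat) \<Rightarrow> complex \<Rightarrow> ('k \<Rightarrow> complex) \<Rightarrow> 'k \<Rightarrow> complex" where
  "wact w t x = (\<lambda>k. t ^ w k * x k)"

definition wclass :: "('k \<Rightarrow> nat) \<Rightarrow> ('k \<Rightarrow> complex) \<Rightarrow> ('k \<Rightarrow> complex) set" where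
  "wclass w x = {wact w t x | t. t \<noteq> 0}"

definition WP :: "'k set \<Rightarrow> ('k \<Rightarrow> nat) \<Rightarrow> ('k \<Rightarrow> complex) set set" where
  "WP I w = wclass w ` (affine_space I - {\<lambda>_. 0})"

definition wp_zeros :: "'k set \<Rightarrow> ('k \<Rightarrow> nat) \<Rightarrow> ('k, complex) mpoly set \<Rightarrow>
    ('k \<Rightarrow> complex) set set" where
  "wp_zeros I w S = {P \<in> WP I w. \<forall>x\<in>P. \<forall>f\<in>S. mpoly_eval f x = 0}"

definition wp_topology :: "'k set \<Rightarrow> ('k \<Rightarrow> nat) \<Rightarrow> ('k \<Rightarrow> complex) set topology" where
  "wp_topology I w = topology (\<lambda>U. \<exists>S \<subseteq> whom_polys I w. U = WP I w - wp_zeros I w S)"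

text \<open>Regular functions are locally fractions of weighted homogeneous polynomials of equal
  degree, as in the structure sheaf of Proj of the polynomial ring graded by \<open>w\<close>.\<close>

definition wp_regular :: "'k set \<Rightarrow> ('k \<Rightarrow> nat) \<Rightarrow> ('k \<Rightarrow> complex) set set \<Rightarrow>
    (('k \<Rightarrow> complex) set \<Rightarrow> complex) \<Rightarrow> bool" where
  "wp_regular I w U h \<longleftrightarrow> (\<forall>P\<in>U. \<exists>U' e. \<exists>f\<in>polys_in I. \<exists>g\<in>polys_in I.
     openin (wp_topology I w) U' \<and> P \<in> U' \<and> U' \<subseteq> U \<and>
     whomogeneous w e f \<and> whomogeneous w e g \<and>
     (\<forall>Q\<in>U'. \<forall>x\<in>Q. mpoly_eval g x \<noteq> 0 \<and> h Q = mpoly_eval f x / mpoly_eval g x))"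

definition well_formed_weights :: "'k set \<Rightarrow> ('k \<Rightarrow> nat) \<Rightarrow> bool" where
  "well_formed_weights I w \<longleftrightarrow> (\<forall>k\<in>I. Gcd (w ` (I - {k})) = 1)"

definition locally_closed_in :: "'p topology \<Rightarrow> 'p set \<Rightarrow> bool" where
  "locally_closed_in X W \<longleftrightarrow> (\<exists>C U. closedin X C \<and> openin X U \<and> W = C \<inter> U)"

definition wp_defined_over_Z :: "'k set \<Rightarrow> ('k \<Rightarrow> nat) \<Rightarrow> ('k \<Rightarrow> complex) set set \<Rightarrow> bool" where
  "wp_defined_over_Z I w W \<longleftrightarrow>
     (\<exists>S T. finite S \<and> finite T \<and> S \<subseteq> whom_polys I w \<and> T \<subseteq> whom_polys I w \<and>
        W = wp_zeros I w (base_change ` S) - wp_zeros I w (base_change ` T))"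

section \<open>Quotients and isomorphisms of spaces with functions\<close>

definition quotient_topology :: "'p topology \<Rightarrow> ('p \<Rightarrow> 'q) \<Rightarrow> 'q topology" where
  "quotient_topology X q =
     topology (\<lambda>U. U \<subseteq> q ` topspace X \<and> openin X {x \<in> topspace X. q x \<in> U})"

definition quotient_regular :: "'p topology \<Rightarrow> ('p set \<Rightarrow> ('p \<Rightarrow> complex) \<Rightarrow> bool) \<Rightarrow>
    ('p \<Rightarrow> 'q) \<Rightarrow> 'q set \<Rightarrow> ('q \<Rightarrow> complex) \<Rightarrow> bool" where
  "quotient_regular X R q U h \<longleftrightarrow> R {x \<in> topspace X. q x \<in> U} (h \<circ> q)"

definition variety_iso :: "'p topology \<Rightarrow> ('p set \<Rightarrow> ('p \<Rightarrow> complex) \<Rightarrow> bool) \<Rightarrow>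
    'q topology \<Rightarrow> ('q set \<Rightarrow> ('q \<Rightarrow> complex) \<Rightarrow> bool) \<Rightarrow> ('p \<Rightarrow> 'q) \<Rightarrow> bool" where
  "variety_iso X R Y R' \<phi> \<longleftrightarrow> homeomorphic_map X Y \<phi> \<and>
     (\<forall>U h. openin Y U \<longrightarrow> (R' U h \<longleftrightarrow> R {x \<in> topspace X. \<phi> x \<in> U} (h \<circ> \<phi>)))"

section \<open>The punctured space of triples\<close>

definition punctured_triples :: "nat \<Rightarrow> nat \<Rightarrow> nat \<Rightarrow> nat \<Rightarrow> nat \<Rightarrow> triple set" where
  "punctured_triples r s d1 d2 d3 = triples r s d1 d2 d3 - {(0, 0, 0)}"

definition punctured_topology :: "nat \<Rightarrow> nat \<Rightarrow> nat \<Rightarrow> nat \<Rightarrow> nat \<Rightarrow> triple topology" where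
  "punctured_topology r s d1 d2 d3 =
     pullback_topology (punctured_triples r s d1 d2 d3) coord_vec
       (affine_topology (coords r s d1 d2 d3))"

definition punctured_regular :: "nat \<Rightarrow> nat \<Rightarrow> nat \<Rightarrow> nat \<Rightarrow> nat \<Rightarrow>
    triple set \<Rightarrow> (triple \<Rightarrow> complex) \<Rightarrow> bool" where
  "punctured_regular r s d1 d2 d3 U h \<longleftrightarrow> (\<forall>T\<in>U. \<exists>U'.
     \<exists>f\<in>polys_in (coords r s d1 d2 d3). \<exists>g\<in>polys_in (coords r s d1 d2 d3).
     openin (punctured_topology r s d1 d2 d3) U' \<and> T \<in> U' \<and> U' \<subseteq> U \<and>
     (\<forall>T'\<in>U'. mpoly_eval g (coord_vec T') \<noteq> 0 \<and>
        h T' = mpoly_eval f (coord_vec T') / mpoly_eval g (coord_vec T')))"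

section \<open>The equations in terms of the coordinates\<close>

text \<open>The universal triple, with independent variables as coefficients. The coefficients of its
  \<open>mu\<close> are the \<open>mu_ij\<close>, as polynomials over the integers in the coordinates.\<close>

definition generic_poly :: "component \<Rightarrow> nat \<Rightarrow> nat \<Rightarrow> nat \<Rightarrow> nat \<Rightarrow> nat \<Rightarrow>
    (coord, int) mpoly bpoly" where
  "generic_poly X r s d1 d2 d3 =
     (\<Sum>(i, j) | (X, i, j) \<in> coords r s d1 d2 d3. bmonom i j (mvar (X, i, j)))"

definition mu_coeff :: "nat \<Rightarrow> nat \<Rightarrow> nat \<Rightarrow> nat \<Rightarrow> nat \<Rightarrow> nat \<Rightarrow> nat \<Rightarrow> (coord, int) mpoly" where
  "mu_coeff r s d1 d2 d3 i j = Poly_Mapping.lookup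
     (mu r s (generic_poly In_A r s d1 d2 d3) (generic_poly In_B r s d1 d2 d3)
       (generic_poly In_L r s d1 d2 d3)) (i, j)"

definition W_locus :: "nat \<Rightarrow> nat \<Rightarrow> nat \<Rightarrow> nat \<Rightarrow> nat \<Rightarrow> (coord \<Rightarrow> complex) set set" where
  "W_locus r s d1 d2 d3 = {P \<in> WP (coords r s d1 d2 d3) weight. \<forall>x\<in>P.
     (\<forall>i j. (i, j) \<noteq> (0, 0) \<longrightarrow> mpoly_eval (base_change (mu_coeff r s d1 d2 d3 i j)) x = 0) \<and>
     mpoly_eval (base_change (mu_coeff r s d1 d2 d3 0 0)) x \<noteq> 0 \<and>
     (\<exists>i j. i + j \<ge> 1 \<and> (In_L, i, j) \<in> coords r s d1 d2 d3 \<and> x (In_L, i, j) \<noteq> 0)}"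

section \<open>Graded Keller maps\<close>

text \<open>The polynomial map \<open>(x^{-s} A, x^{-r} B, x \<Lambda>)\<close> with \<open>u = x^r y\<close>, \<open>v = x^s z\<close>, expanded so that
  it also makes sense at \<open>x = 0\<close>: on the spaces \<open>V_A\<close> and \<open>V_B\<close> the exponents
  \<open>r i + s j - s\<close> and \<open>r i + s j - r\<close> are nonnegative, so no subtraction is truncated.\<close>

definition graded_map :: "nat \<Rightarrow> nat \<Rightarrow> triple \<Rightarrow>
    complex \<times> complex \<times> complex \<Rightarrow> complex \<times> complex \<times> complex" where
  "graded_map r s = (\<lambda>(A, B, L) (x, y, z).
     (\<Sum>(i, j)\<in>Poly_Mapping.keys A.
        Poly_Mapping.lookup A (i, j) * x ^ (r * i + s * j - s) * y ^ i * z ^ j,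
      \<Sum>(i, j)\<in>Poly_Mapping.keys B.
        Poly_Mapping.lookup B (i, j) * x ^ (r * i + s * j - r) * y ^ i * z ^ j,
      x * (\<Sum>(i, j)\<in>Poly_Mapping.keys L.
        Poly_Mapping.lookup L (i, j) * (x ^ r * y) ^ i * (x ^ s * z) ^ j)))"

text \<open>The Jacobian determinant of the map of a triple is a nonzero constant iff its \<open>mu\<close> is, so
  the Keller condition is imposed on \<open>mu\<close>.\<close>

definition keller_triples :: "nat \<Rightarrow> nat \<Rightarrow> nat \<Rightarrow> nat \<Rightarrow> nat \<Rightarrow> triple set" where
  "keller_triples r s d1 d2 d3 = {(A, B, L) \<in> triples r s d1 d2 d3.
     total_degree L \<ge> 1 \<and> (\<exists>c. c \<noteq> 0 \<and> mu r s A B L = bmonom 0 0 c)}"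

definition keller_maps :: "nat \<Rightarrow> nat \<Rightarrow> nat \<Rightarrow> nat \<Rightarrow> nat \<Rightarrow>
    (complex \<times> complex \<times> complex \<Rightarrow> complex \<times> complex \<times> complex) set" where
  "keller_maps r s d1 d2 d3 = graded_map r s ` keller_triples r s d1 d2 d3"

end

theory Submission
  imports Defs
begin

text \<open>Taking coefficients identifies the space of triples with the affine space over \<open>coords\<close>, and
  it turns the action on triples into the action \<open>x \<mapsto> t^w x\<close> that defines weighted projective
  space. As sets, the quotient and \<open>WP\<close> therefore agree. That they agree as varieties needs an
  argument, because \<open>WP\<close> carries the topology and the functions of Proj, which are given by weighted
  homogeneous polynomials only, whereas open sets and regular functions on the punctured space of
  triples may use arbitrary polynomials.

  The bridge is the identity \<open>p(t x) = \<Sum>e. t^e p_e(x)\<close> with the weighted homogeneous parts \<open>p_e\<close> of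
  \<open>p\<close> (\<open>mpoly_eval_hom_parts\<close>). A polynomial in \<open>t\<close> over the complex numbers that is not zero has
  only finitely many roots. So \<open>p\<close> is nonzero somewhere on an orbit iff some \<open>p_e\<close> is nonzero on
  it, which shows that \<open>WP\<close> has the quotient topology (\<open>openin_wp_iff\<close>). If an invariant function
  is \<open>f / g\<close> near a point, then \<open>f = h g\<close> holds along almost all of each nearby orbit with \<open>h\<close>
  constant there; comparing coefficients of powers of \<open>t\<close> gives \<open>f_e = h g_e\<close> for all \<open>e\<close>
  (\<open>hom_part_proportional\<close>). Choosing \<open>e\<close> with \<open>g_e\<close> nonzero at the point represents the function as
  a fraction of weighted homogeneous polynomials of equal degree (\<open>wp_regular_iff\<close>).

  The statements on \<open>mu\<close> are about its coefficients for the generic triple. Evaluation at a point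
  is a ring homomorphism, and \<open>mu\<close> is built from ring operations and derivatives, so specializing
  the generic coefficients gives those of a concrete triple (\<open>lookup_mu\<close>). The weighted degree
  \<open>5 + i + j\<close> is obtained by counting: a coefficient of \<open>u^i v^j\<close> has weight \<open>1 + i + j\<close>, each of the
  three factors contributes the \<open>1\<close> and each of the two derivatives one more (\<open>mu_coeff_hom\<close>). Hence
  the Keller locus is the difference of two zero loci of finitely many weighted homogeneous
  polynomials with integral coefficients (\<open>W_locus_zeros\<close>), and its points are the orbits of Keller
  triples. Finally a triple is recovered from its graded map by restricting the map to the plane
  \<open>x = 1\<close>.\<close>

section \<open>Convolution products of finitely supported functions\<close>

text \<open>The sums run over arbitrary finite sets containing the supports, so that a product and its
  image under a change of coefficients can be expanded over the same index sets.\<close>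

lemma lookup_mult_finite:
  fixes p q :: "'m::monoid_add \<Rightarrow>\<^sub>0 'a::comm_ring_1"
  assumes "finite A" "finite B" "Poly_Mapping.keys p \<subseteq> A" "Poly_Mapping.keys q \<subseteq> B"
  shows "Poly_Mapping.lookup (p * q) k =
    (\<Sum>a\<in>A. \<Sum>b\<in>B. Poly_Mapping.lookup p a * Poly_Mapping.lookup q b when a + b = k)"
proof -
  have inner: "(\<Sum>b. Poly_Mapping.lookup q b when k = a + b) =
      (\<Sum>b\<in>B. Poly_Mapping.lookup q b when a + b = k)" for a
    using assms by (subst Sum_any.expand_superset[of B])
      (auto simp: in_keys_iff when_def intro!: sum.cong)
  have outside: "Poly_Mapping.lookup p a = 0" if "a \<notin> A" for a
    using assms(3) that by (auto simp: in_keys_iff)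
  have "Poly_Mapping.lookup (p * q) k =
      (\<Sum>a\<in>A. Poly_Mapping.lookup p a * (\<Sum>b\<in>B. Poly_Mapping.lookup q b when a + b = k))"
    unfolding lookup_mult inner
    using assms(1) outside by (subst Sum_any.expand_superset[of A]) force+
  then show ?thesis by (simp add: sum_distrib_left mult_when)
qed

lemma lookup_of_nat_mult:
  fixes p :: "'m::monoid_add \<Rightarrow>\<^sub>0 'a::comm_ring_1"
  shows "Poly_Mapping.lookup (of_nat n * p) k = of_nat n * Poly_Mapping.lookup p k"
  by (induction n) (simp_all add: lookup_add distrib_right)

text \<open>A ring homomorphism \<open>h\<close> on coefficients and a multiplicative map \<open>\<phi>\<close> on exponents together
  give a ring homomorphism on polynomials. Evaluation of complex polynomials and evaluation of
  integral polynomials at complex points are both of this shape, and the latter is again a map to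
  apply to coefficients when the generic triple is specialized.\<close>

locale coeff_hom =
  fixes h :: "'a::comm_ring_1 \<Rightarrow> 'b::comm_ring_1"
  assumes h_add: "h (x + y) = h x + h y" and h_mult: "h (x * y) = h x * h y" and h_one: "h 1 = 1"
begin

lemma h_zero: "h 0 = 0"
  using h_add[of 0 0] by simp

lemma h_diff: "h (x - y) = h x - h y"
  using h_add[of "x - y" y] by (simp add: algebra_simps)

lemma h_of_nat: "h (of_nat n) = of_nat n"
  by (induction n) (simp_all add: h_zero h_add h_one)

lemma h_sum: "h (sum f A) = (\<Sum>a\<in>A. h (f a))"
  by (induction A rule: infinite_finite_induct) (simp_all add: h_zero h_add)

lemma h_when: "h (x when P) = (h x when P)"
  by (simp add: when_def h_zero)

definition lift :: "('m \<Rightarrow> 'b) \<Rightarrow> ('m \<Rightarrow>\<^sub>0 'a) \<Rightarrow> 'b" where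
  "lift \<phi> p = (\<Sum>m\<in>Poly_Mapping.keys p. h (Poly_Mapping.lookup p m) * \<phi> m)"

lemma lift_superset:
  assumes "finite M" "Poly_Mapping.keys p \<subseteq> M"
  shows "lift \<phi> p = (\<Sum>m\<in>M. h (Poly_Mapping.lookup p m) * \<phi> m)"
  unfolding lift_def using assms
  by (intro sum.mono_neutral_left) (auto simp: in_keys_iff h_zero)

lemma lift_add: "lift \<phi> (p + q) = lift \<phi> p + lift \<phi> q"
proof -
  let ?M = "Poly_Mapping.keys p \<union> Poly_Mapping.keys q"
  have "lift \<phi> f = (\<Sum>m\<in>?M. h (Poly_Mapping.lookup f m) * \<phi> m)" if "f \<in> {p, q, p + q}" for f
    using that keys_add[of p q] by (intro lift_superset) auto
  then show ?thesis by (simp add: lookup_add h_add distrib_right sum.distrib)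
qed

lemma lift_mult:
  fixes p q :: "'m::comm_monoid_add \<Rightarrow>\<^sub>0 'a"
  assumes "\<And>m n. \<phi> (m + n) = \<phi> m * \<phi> n"
  shows "lift \<phi> (p * q) = lift \<phi> p * lift \<phi> q"
proof -
  let ?A = "Poly_Mapping.keys p" and ?B = "Poly_Mapping.keys q"
  let ?K = "(\<lambda>(a, b). a + b) ` (?A \<times> ?B)"
  have "lift \<phi> (p * q) = (\<Sum>k\<in>?K. h (Poly_Mapping.lookup (p * q) k) * \<phi> k)"
    using keys_mult[of p q] by (intro lift_superset) auto
  also have "\<dots> = (\<Sum>k\<in>?K. \<Sum>a\<in>?A. \<Sum>b\<in>?B.
      (h (Poly_Mapping.lookup p a) * h (Poly_Mapping.lookup q b) * \<phi> k when a + b = k))"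
    by (simp add: lookup_mult_finite[of ?A ?B] h_sum h_when h_mult sum_distrib_right when_mult)
  also have "\<dots> = (\<Sum>a\<in>?A. \<Sum>b\<in>?B. \<Sum>k\<in>?K.
      (h (Poly_Mapping.lookup p a) * h (Poly_Mapping.lookup q b) * \<phi> k when a + b = k))"
    by (rule trans[OF sum.swap], rule sum.cong[OF refl], rule sum.swap)
  also have "\<dots> = (\<Sum>a\<in>?A. \<Sum>b\<in>?B.
      h (Poly_Mapping.lookup p a) * h (Poly_Mapping.lookup q b) * \<phi> (a + b))"
    by (intro sum.cong refl) (auto simp: when_def)
  also have "\<dots> = lift \<phi> p * lift \<phi> q"
    by (simp add: lift_def sum_product assms algebra_simps)
  finally show ?thesis .
qed

end

section \<open>Evaluation of multivariate polynomials\<close>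

definition mono_eval :: "('k \<Rightarrow>\<^sub>0 nat) \<Rightarrow> ('k \<Rightarrow> 'a::comm_ring_1) \<Rightarrow> 'a" where
  "mono_eval m x = (\<Prod>k\<in>Poly_Mapping.keys m. x k ^ Poly_Mapping.lookup m k)"

lemma mono_eval_superset:
  assumes "finite K" "Poly_Mapping.keys m \<subseteq> K"
  shows "mono_eval m x = (\<Prod>k\<in>K. x k ^ Poly_Mapping.lookup m k)"
  unfolding mono_eval_def using assms by (intro prod.mono_neutral_left) (auto simp: in_keys_iff)

lemma mono_eval_add: "mono_eval (m + n) x = mono_eval m x * mono_eval n x"
proof -
  let ?K = "Poly_Mapping.keys m \<union> Poly_Mapping.keys n"
  have "mono_eval l x = (\<Prod>k\<in>?K. x k ^ Poly_Mapping.lookup l k)" if "l \<in> {m, n, m + n}" for l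
    using that keys_add[of m n] by (intro mono_eval_superset) auto
  then show ?thesis by (simp add: lookup_add power_add prod.distrib)
qed

lemma mpoly_eval_mono_eval:
  "mpoly_eval f x = (\<Sum>m\<in>Poly_Mapping.keys f. Poly_Mapping.lookup f m * mono_eval m x)"
  by (simp add: mpoly_eval_def mono_eval_def)

interpretation id_hom: coeff_hom "\<lambda>c. c :: 'a::comm_ring_1"
  by unfold_locales auto

interpretation of_int_hom: coeff_hom "of_int :: int \<Rightarrow> complex"
  by unfold_locales auto

lemma mpoly_eval_lift: "mpoly_eval f x = id_hom.lift (\<lambda>m. mono_eval m x) f"
  by (simp add: mpoly_eval_mono_eval id_hom.lift_def)

lemma mpoly_eval_mult: "mpoly_eval (f * g) x = mpoly_eval f x * mpoly_eval g x"
  by (simp add: mpoly_eval_lift id_hom.lift_mult mono_eval_add)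

lemma mpoly_eval_one [simp]: "mpoly_eval 1 x = 1"
  by (simp add: mpoly_eval_def)

lemma lookup_base_change:
  "Poly_Mapping.lookup (base_change f) m = of_int (Poly_Mapping.lookup f m)"
  by (simp add: base_change_def Poly_Mapping.map.rep_eq when_def)

lemma keys_base_change: "Poly_Mapping.keys (base_change f) = Poly_Mapping.keys f"
  by (auto simp: in_keys_iff lookup_base_change)

definition int_eval :: "('k \<Rightarrow> complex) \<Rightarrow> ('k, int) mpoly \<Rightarrow> complex" where
  "int_eval x f = mpoly_eval (base_change f) x"

lemma int_eval_lift: "int_eval x f = of_int_hom.lift (\<lambda>m. mono_eval m x) f"
  by (simp add: int_eval_def mpoly_eval_mono_eval of_int_hom.lift_def keys_base_change
      lookup_base_change)

lemma int_eval_mvar: "int_eval x (mvar k) = x k"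
  by (simp add: int_eval_lift of_int_hom.lift_def mvar_def mono_eval_def)

interpretation int_eval: coeff_hom "int_eval x" for x
proof
  show "int_eval x (f + g) = int_eval x f + int_eval x g" for f g
    by (simp add: int_eval_lift of_int_hom.lift_add)
  show "int_eval x (f * g) = int_eval x f * int_eval x g" for f g
    by (simp add: int_eval_lift of_int_hom.lift_mult mono_eval_add)
  show "int_eval x 1 = 1"
    by (simp add: int_eval_lift of_int_hom.lift_def mono_eval_def)
qed

section \<open>Weighted homogeneous polynomials\<close>

definition wdeg :: "('k \<Rightarrow> nat) \<Rightarrow> ('k \<Rightarrow>\<^sub>0 nat) \<Rightarrow> nat" where
  "wdeg w m = (\<Sum>k\<in>Poly_Mapping.keys m. Poly_Mapping.lookup m k * w k)"

lemma wdeg_superset: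
  assumes "finite K" "Poly_Mapping.keys m \<subseteq> K"
  shows "wdeg w m = (\<Sum>k\<in>K. Poly_Mapping.lookup m k * w k)"
  unfolding wdeg_def using assms by (intro sum.mono_neutral_left) (auto simp: in_keys_iff)

lemma wdeg_add: "wdeg w (m + n) = wdeg w m + wdeg w n"
proof -
  let ?K = "Poly_Mapping.keys m \<union> Poly_Mapping.keys n"
  have "wdeg w l = (\<Sum>k\<in>?K. Poly_Mapping.lookup l k * w k)" if "l \<in> {m, n, m + n}" for l
    using that keys_add[of m n] by (intro wdeg_superset) auto
  then show ?thesis by (simp add: lookup_add distrib_right sum.distrib)
qed

lemma mono_eval_wact: "mono_eval m (wact w t x) = t ^ wdeg w m * mono_eval m x"
  by (simp add: mono_eval_def wact_def wdeg_def power_mult_distrib prod.distrib power_sum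
      mult.commute flip: power_mult)

lemma whomogeneous_wdeg: "whomogeneous w e f \<longleftrightarrow> (\<forall>m\<in>Poly_Mapping.keys f. wdeg w m = e)"
  by (simp add: whomogeneous_def wdeg_def)

definition hom_polys :: "'k set \<Rightarrow> ('k \<Rightarrow> nat) \<Rightarrow> nat \<Rightarrow> ('k, 'a::comm_ring_1) mpoly set" where
  "hom_polys I w e = {f \<in> polys_in I. whomogeneous w e f}"

lemma hom_polys_iff:
  "f \<in> hom_polys I w e \<longleftrightarrow> (\<forall>m\<in>Poly_Mapping.keys f. Poly_Mapping.keys m \<subseteq> I \<and> wdeg w m = e)"
  by (auto simp: hom_polys_def polys_in_def whomogeneous_wdeg)

lemma whom_polys_iff: "f \<in> whom_polys I w \<longleftrightarrow> (\<exists>e. f \<in> hom_polys I w e)"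
  by (auto simp: whom_polys_def hom_polys_def)

lemma hom_polys_zero [simp]: "0 \<in> hom_polys I w e"
  by (simp add: hom_polys_iff)

lemma hom_polys_one: "1 \<in> hom_polys I w 0"
  by (auto simp: hom_polys_iff wdeg_def)

lemma hom_polys_mvar: "k \<in> I \<Longrightarrow> mvar k \<in> hom_polys I w (w k)"
  by (auto simp: hom_polys_iff mvar_def wdeg_def)

lemma hom_polys_add: "f \<in> hom_polys I w e \<Longrightarrow> g \<in> hom_polys I w e \<Longrightarrow> f + g \<in> hom_polys I w e"
  using keys_add[of f g] by (auto simp: hom_polys_iff)

lemma hom_polys_diff: "f \<in> hom_polys I w e \<Longrightarrow> g \<in> hom_polys I w e \<Longrightarrow> f - g \<in> hom_polys I w e"
proof -
  assume "f \<in> hom_polys I w e" "g \<in> hom_polys I w e"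
  moreover have "Poly_Mapping.keys (f - g) \<subseteq> Poly_Mapping.keys f \<union> Poly_Mapping.keys g"
    by (auto simp: in_keys_iff lookup_minus)
  ultimately show ?thesis by (auto simp: hom_polys_iff)
qed

lemma hom_polys_sum: "(\<And>a. a \<in> A \<Longrightarrow> f a \<in> hom_polys I w e) \<Longrightarrow> sum f A \<in> hom_polys I w e"
  by (induction A rule: infinite_finite_induct) (auto intro: hom_polys_add)

lemma hom_polys_of_nat_mult: "f \<in> hom_polys I w e \<Longrightarrow> of_nat n * f \<in> hom_polys I w e"
  by (induction n) (auto simp: distrib_right intro: hom_polys_add)

lemma polys_in_mult: "f \<in> polys_in I \<Longrightarrow> g \<in> polys_in I \<Longrightarrow> f * g \<in> polys_in I"
proof -
  assume f: "f \<in> polys_in I" and g: "g \<in> polys_in I"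
  show ?thesis unfolding polys_in_def
  proof (intro CollectI ballI)
    fix m assume "m \<in> Poly_Mapping.keys (f * g)"
    then obtain a b where "m = a + b" "a \<in> Poly_Mapping.keys f" "b \<in> Poly_Mapping.keys g"
      using keys_mult[of f g] by blast
    then show "Poly_Mapping.keys m \<subseteq> I"
      using f g keys_add[of a b] unfolding polys_in_def by blast
  qed
qed

lemma hom_polys_mult:
  "f \<in> hom_polys I w d \<Longrightarrow> g \<in> hom_polys I w e \<Longrightarrow> f * g \<in> hom_polys I w (d + e)"
proof -
  assume f: "f \<in> hom_polys I w d" and g: "g \<in> hom_polys I w e"
  have "wdeg w m = d + e" if m: "m \<in> Poly_Mapping.keys (f * g)" for m
  proof -
    obtain a b where ab: "m = a + b" "a \<in> Poly_Mapping.keys f" "b \<in> Poly_Mapping.keys g"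
      using keys_mult[of f g] m by blast
    then have "wdeg w a = d" "wdeg w b = e" using f g unfolding hom_polys_iff by blast+
    then show ?thesis by (simp add: ab wdeg_add)
  qed
  then show ?thesis
    using f g polys_in_mult[of f I g] by (simp add: hom_polys_def whomogeneous_wdeg)
qed

lemma whom_polys_mult:
  "f \<in> whom_polys I w \<Longrightarrow> g \<in> whom_polys I w \<Longrightarrow> f * g \<in> whom_polys I w"
  unfolding whom_polys_iff by (blast intro: hom_polys_mult)

lemma base_change_hom_polys: "f \<in> hom_polys I w e \<Longrightarrow> base_change f \<in> hom_polys I w e"
  by (simp add: hom_polys_iff keys_base_change)

lemma mpoly_eval_wact_hom:
  assumes "f \<in> hom_polys I w e"
  shows "mpoly_eval f (wact w t x) = t ^ e * mpoly_eval f x"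
  using assms by (auto simp: mpoly_eval_mono_eval mono_eval_wact sum_distrib_left hom_polys_iff
      mult.left_commute intro!: sum.cong)

definition hom_part :: "('k \<Rightarrow> nat) \<Rightarrow> nat \<Rightarrow> ('k, 'a::comm_ring_1) mpoly \<Rightarrow> ('k, 'a) mpoly" where
  "hom_part w e = Poly_Mapping.mapp (\<lambda>m c. if wdeg w m = e then c else 0)"

lemma lookup_hom_part:
  "Poly_Mapping.lookup (hom_part w e f) m = (if wdeg w m = e then Poly_Mapping.lookup f m else 0)"
  by (auto simp: hom_part_def lookup_mapp when_def in_keys_iff)

lemma keys_hom_part: "Poly_Mapping.keys (hom_part w e f) = {m \<in> Poly_Mapping.keys f. wdeg w m = e}"
  by (auto simp: in_keys_iff lookup_hom_part split: if_splits)

lemma hom_part_in: "f \<in> polys_in I \<Longrightarrow> hom_part w e f \<in> hom_polys I w e"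
  by (auto simp: hom_polys_iff keys_hom_part polys_in_def)

definition wdeg_bound :: "('k \<Rightarrow> nat) \<Rightarrow> ('k, 'a::comm_ring_1) mpoly \<Rightarrow> nat" where
  "wdeg_bound w f = Max (insert 0 (wdeg w ` Poly_Mapping.keys f))"

lemma wdeg_le_bound: "m \<in> Poly_Mapping.keys f \<Longrightarrow> wdeg w m \<le> wdeg_bound w f"
  by (simp add: wdeg_bound_def)

lemma hom_part_beyond: "wdeg_bound w f < e \<Longrightarrow> hom_part w e f = 0"
proof (rule poly_mapping_eqI)
  fix m assume e: "wdeg_bound w f < e"
  have "Poly_Mapping.lookup f m = 0" if "wdeg w m = e"
    using wdeg_le_bound[of m f w] e that by (cases "m \<in> Poly_Mapping.keys f") (auto simp: in_keys_iff)
  then show "Poly_Mapping.lookup (hom_part w e f) m = Poly_Mapping.lookup 0 m"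
    by (simp add: lookup_hom_part)
qed

text \<open>Along an orbit a polynomial becomes a polynomial in one variable, the orbit parameter, whose
  coefficients are the values of its weighted homogeneous parts. Orbits are then controlled by the
  fact that a nonzero polynomial in one variable has finitely many roots.\<close>

lemma mpoly_eval_hom_parts:
  assumes "wdeg_bound w f \<le> D"
  shows "mpoly_eval f (wact w t x) = (\<Sum>e\<le>D. mpoly_eval (hom_part w e f) x * t ^ e)"
proof -
  let ?K = "Poly_Mapping.keys f"
  have part: "mpoly_eval (hom_part w e f) x =
      (\<Sum>m\<in>?K. if wdeg w m = e then Poly_Mapping.lookup f m * mono_eval m x else 0)" for e
    unfolding mpoly_eval_mono_eval keys_hom_part
    by (subst sum.inter_filter[symmetric]) (auto simp: lookup_hom_part intro!: sum.cong)
  have "(\<Sum>e\<le>D. mpoly_eval (hom_part w e f) x * t ^ e) =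
      (\<Sum>e\<le>D. \<Sum>m\<in>?K. if wdeg w m = e then Poly_Mapping.lookup f m * mono_eval m x * t ^ e else 0)"
    unfolding part sum_distrib_right by (intro sum.cong refl) auto
  also have "\<dots> =
      (\<Sum>m\<in>?K. \<Sum>e\<le>D. if wdeg w m = e then Poly_Mapping.lookup f m * mono_eval m x * t ^ e else 0)"
    by (rule sum.swap)
  also have "\<dots> = (\<Sum>m\<in>?K. Poly_Mapping.lookup f m * mono_eval m x * t ^ wdeg w m)"
    using assms wdeg_le_bound[of _ f w] by (intro sum.cong refl) fastforce
  also have "\<dots> = mpoly_eval f (wact w t x)"
    by (simp add: mpoly_eval_mono_eval mono_eval_wact mult_ac)
  finally show ?thesis by simp
qed

lemma wact_one [simp]: "wact w 1 x = x"
  by (simp add: wact_def)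

lemma hom_part_nonzero:
  fixes x :: "'k \<Rightarrow> complex"
  assumes "mpoly_eval f x \<noteq> 0"
  shows "\<exists>e\<le>wdeg_bound w f. mpoly_eval (hom_part w e f) x \<noteq> 0"
proof (rule ccontr)
  assume "\<not> ?thesis"
  then have "(\<Sum>e\<le>wdeg_bound w f. mpoly_eval (hom_part w e f) x * 1 ^ e) = 0"
    by (intro sum.neutral) auto
  then show False
    using assms mpoly_eval_hom_parts[of w f "wdeg_bound w f" 1 x] by simp
qed

lemma finite_zeros_on_orbit:
  fixes x :: "'k \<Rightarrow> complex"
  assumes "mpoly_eval (hom_part w e f) x \<noteq> 0"
  shows "finite {t. mpoly_eval f (wact w t x) = 0}"
proof -
  have "e \<le> wdeg_bound w f"
    using assms hom_part_beyond[of w f e] by (auto simp: mpoly_eval_def intro: leI)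
  then show ?thesis
    unfolding mpoly_eval_hom_parts[OF order.refl] polyfun_finite_roots using assms by blast
qed

lemma nonzero_on_orbit:
  fixes x :: "'k \<Rightarrow> complex"
  assumes "mpoly_eval (hom_part w e f) x \<noteq> 0"
  obtains t where "t \<noteq> 0" "mpoly_eval f (wact w t x) \<noteq> 0"
proof -
  have "finite (insert 0 {t. mpoly_eval f (wact w t x) = 0})"
    using finite_zeros_on_orbit[OF assms] by simp
  then show ?thesis
    using that ex_new_if_finite[OF infinite_UNIV_char_0] by blast
qed

text \<open>The step that makes invariant functions homogeneous. If \<open>f = c g\<close> at cofinitely many points
  of an orbit, then both sides are the same polynomial in the parameter \<open>t\<close>, so the weighted
  homogeneous parts of \<open>f\<close> and \<open>g\<close> satisfy the same relation degree by degree.\<close>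

lemma hom_part_proportional:
  fixes x :: "'k \<Rightarrow> complex"
  assumes p: "mpoly_eval p x \<noteq> 0"
    and fg: "\<And>t. t \<noteq> 0 \<Longrightarrow> mpoly_eval p (wact w t x) \<noteq> 0 \<Longrightarrow>
      mpoly_eval f (wact w t x) = c * mpoly_eval g (wact w t x)"
  shows "mpoly_eval (hom_part w e f) x = c * mpoly_eval (hom_part w e g) x"
proof (cases "e \<le> max (wdeg_bound w f) (wdeg_bound w g)")
  case True
  let ?D = "max (wdeg_bound w f) (wdeg_bound w g)"
  let ?c = "\<lambda>i. mpoly_eval (hom_part w i f) x - c * mpoly_eval (hom_part w i g) x"
  let ?R = "{t. (\<Sum>i\<le>?D. ?c i * t ^ i) = 0}"
  have diff: "(\<Sum>i\<le>?D. ?c i * t ^ i) =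
      mpoly_eval f (wact w t x) - c * mpoly_eval g (wact w t x)" for t
    by (simp add: mpoly_eval_hom_parts[of w f ?D] mpoly_eval_hom_parts[of w g ?D]
        sum_subtractf sum_distrib_left left_diff_distrib mult.assoc)
  obtain d where "mpoly_eval (hom_part w d p) x \<noteq> 0"
    using hom_part_nonzero[OF p] by blast
  then have fin: "finite (insert 0 {t. mpoly_eval p (wact w t x) = 0})"
    using finite_zeros_on_orbit by simp
  have cover: "UNIV = insert 0 {t. mpoly_eval p (wact w t x) = 0} \<union> ?R"
    unfolding diff using fg by auto
  have "infinite ?R"
  proof
    assume "finite ?R"
    then have "finite (UNIV :: complex set)"
      unfolding cover using fin by (rule finite_UnI[rotated])
    then show False using infinite_UNIV_char_0 by blast
  qed
  then have "\<forall>i\<le>?D. ?c i = 0"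
    unfolding polyfun_finite_roots by blast
  then show ?thesis
    using True by (metis right_minus_eq)
next
  case False
  then show ?thesis by (simp add: hom_part_beyond mpoly_eval_def)
qed

section \<open>Zariski topologies\<close>

text \<open>Common to affine and weighted projective space: complements of zero loci form a topology as
  soon as any union of two zero loci is again one. \<open>Z f P\<close> says that \<open>f\<close> vanishes at \<open>P\<close>.\<close>

lemma istopology_zero_complements:
  assumes "\<And>f g. f \<in> R \<Longrightarrow> g \<in> R \<Longrightarrow> \<exists>h\<in>R. \<forall>P\<in>X. Z h P \<longleftrightarrow> Z f P \<or> Z g P"
  shows "istopology (\<lambda>U. \<exists>S\<subseteq>R. U = X - {P \<in> X. \<forall>f\<in>S. Z f P})"
  unfolding istopology_def
proof (intro conjI allI impI)
  fix U V
  assume "\<exists>S\<subseteq>R. U = X - {P \<in> X. \<forall>f\<in>S. Z f P}" "\<exists>S\<subseteq>R. V = X - {P \<in> X. \<forall>f\<in>S. Z f P}"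
  then obtain S T where ST: "S \<subseteq> R" "T \<subseteq> R"
    and U: "U = X - {P \<in> X. \<forall>f\<in>S. Z f P}" and V: "V = X - {P \<in> X. \<forall>f\<in>T. Z f P}"
    by blast
  \<comment> \<open>the elements that serve as products \<open>f g\<close>\<close>
  let ?H = "{h \<in> R. \<exists>f\<in>S. \<exists>g\<in>T. \<forall>P\<in>X. Z h P \<longleftrightarrow> Z f P \<or> Z g P}"
  have "U \<inter> V = X - {P \<in> X. \<forall>h\<in>?H. Z h P}"
  proof (intro equalityI subsetI)
    fix P assume "P \<in> U \<inter> V"
    then obtain f g where "P \<in> X" "f \<in> S" "g \<in> T" "\<not> Z f P" "\<not> Z g P"
      unfolding U V by blast
    moreover then obtain h where "h \<in> R" "\<forall>P\<in>X. Z h P \<longleftrightarrow> Z f P \<or> Z g P"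
      using assms ST by blast
    ultimately show "P \<in> X - {P \<in> X. \<forall>h\<in>?H. Z h P}" by blast
  qed (auto simp: U V)
  then show "\<exists>S\<subseteq>R. U \<inter> V = X - {P \<in> X. \<forall>f\<in>S. Z f P}"
    by (intro exI[of _ ?H]) blast
next
  fix \<K> assume \<K>: "\<forall>U\<in>\<K>. \<exists>S\<subseteq>R. U = X - {P \<in> X. \<forall>f\<in>S. Z f P}"
  \<comment> \<open>the largest possible family: this avoids choosing one family for each member of the union\<close>
  let ?H = "{f \<in> R. {P \<in> X. \<not> Z f P} \<subseteq> \<Union>\<K>}"
  have "\<Union>\<K> = X - {P \<in> X. \<forall>f\<in>?H. Z f P}"
  proof (intro equalityI subsetI)
    fix P assume "P \<in> \<Union>\<K>"
    then obtain U where U: "U \<in> \<K>" "P \<in> U" by blast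
    then obtain S where S: "S \<subseteq> R" "U = X - {P \<in> X. \<forall>f\<in>S. Z f P}" using \<K> by blast
    then obtain f where f: "P \<in> X" "f \<in> S" "\<not> Z f P" using U by blast
    then have "f \<in> ?H" using S U by blast
    then show "P \<in> X - {P \<in> X. \<forall>f\<in>?H. Z f P}" using f by blast
  qed blast
  then show "\<exists>S\<subseteq>R. \<Union>\<K> = X - {P \<in> X. \<forall>f\<in>S. Z f P}"
    by (intro exI[of _ ?H]) blast
qed

lemma polys_in_one: "1 \<in> polys_in I"
  by (simp add: polys_in_def)

lemma openin_affine:
  "openin (affine_topology I) U \<longleftrightarrow>
    (\<exists>S\<subseteq>polys_in I. U = affine_space I - {x \<in> affine_space I. \<forall>f\<in>S. mpoly_eval f x = 0})"
proof -
  have "istopology (\<lambda>U. \<exists>S\<subseteq>polys_in I.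
      U = affine_space I - {x \<in> affine_space I. \<forall>f\<in>S. mpoly_eval f x = 0})"
  proof (rule istopology_zero_complements)
    fix f g :: "('a, complex) mpoly"
    assume "f \<in> polys_in I" "g \<in> polys_in I"
    then show "\<exists>h\<in>polys_in I. \<forall>x\<in>affine_space I.
        mpoly_eval h x = 0 \<longleftrightarrow> mpoly_eval f x = 0 \<or> mpoly_eval g x = 0"
      by (intro bexI[of _ "f * g"]) (auto simp: mpoly_eval_mult polys_in_mult)
  qed
  then show ?thesis by (simp add: affine_topology_def)
qed

lemma topspace_affine: "topspace (affine_topology I) = affine_space I"
proof
  show "topspace (affine_topology I) \<subseteq> affine_space I"
    unfolding topspace_def openin_affine by blast
  have "openin (affine_topology I) (affine_space I)"
    unfolding openin_affine using polys_in_one by (intro exI[of _ "{1}"]) auto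
  then show "affine_space I \<subseteq> topspace (affine_topology I)" by (rule openin_subset)
qed

section \<open>Weighted projective space as a quotient\<close>

definition punctured :: "'k set \<Rightarrow> ('k \<Rightarrow> complex) set" where
  "punctured I = affine_space I - {\<lambda>_. 0}"

lemma wact_wact: "wact w a (wact w b x) = wact w (a * b) x"
  by (simp add: wact_def power_mult_distrib mult.assoc)

lemma wact_punctured: "x \<in> punctured I \<Longrightarrow> t \<noteq> 0 \<Longrightarrow> wact w t x \<in> punctured I"
  by (auto simp: punctured_def affine_space_def wact_def fun_eq_iff)

lemma mem_wclass: "y \<in> wclass w x \<longleftrightarrow> (\<exists>t. t \<noteq> 0 \<and> y = wact w t x)"
  by (auto simp: wclass_def)

lemma wclass_self: "x \<in> wclass w x"
  unfolding mem_wclass by (rule exI[of _ 1]) simp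

lemma wclass_wact: "t \<noteq> 0 \<Longrightarrow> wclass w (wact w t x) = wclass w x"
proof (intro set_eqI iffI)
  fix y assume t: "t \<noteq> 0"
  show "y \<in> wclass w x" if y: "y \<in> wclass w (wact w t x)"
  proof -
    obtain a where "a \<noteq> 0" "y = wact w a (wact w t x)" using y unfolding mem_wclass by blast
    then show ?thesis
      using t unfolding mem_wclass wact_wact by (intro exI[of _ "a * t"]) simp
  qed
  show "y \<in> wclass w (wact w t x)" if y: "y \<in> wclass w x"
  proof -
    obtain a where "a \<noteq> 0" "y = wact w a x" using y unfolding mem_wclass by blast
    then show ?thesis
      using t unfolding mem_wclass wact_wact by (intro exI[of _ "a / t"]) simp
  qed
qed

lemma wclass_eqD: "y \<in> wclass w x \<Longrightarrow> wclass w y = wclass w x"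
  by (auto simp: mem_wclass wclass_wact)

lemma WP_punctured: "WP I w = wclass w ` punctured I"
  by (simp add: WP_def punctured_def)

lemma wclass_in_WP: "x \<in> punctured I \<Longrightarrow> wclass w x \<in> WP I w"
  by (simp add: WP_punctured)

lemma mem_WP_elim:
  assumes "P \<in> WP I w" "x \<in> P"
  shows "x \<in> punctured I" "P = wclass w x"
proof -
  obtain y where y: "y \<in> punctured I" "P = wclass w y"
    using assms(1) by (auto simp: WP_punctured)
  have "x \<in> wclass w y" using assms(2) y(2) by simp
  then show "P = wclass w x" by (simp add: y(2) wclass_eqD)
  from \<open>x \<in> wclass w y\<close> obtain t where "t \<noteq> 0" "x = wact w t y" unfolding mem_wclass by blast
  then show "x \<in> punctured I" using y(1) by (simp add: wact_punctured)
qed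

text \<open>Vanishing of a weighted homogeneous polynomial is a property of the orbit, so it may be tested
  at one representative.\<close>

lemma whom_polys_vanish:
  assumes "f \<in> whom_polys I w"
  shows "(\<forall>y\<in>wclass w x. mpoly_eval f y = 0) \<longleftrightarrow> mpoly_eval f x = 0"
proof
  assume "\<forall>y\<in>wclass w x. mpoly_eval f y = 0"
  then show "mpoly_eval f x = 0" using wclass_self by blast
next
  assume "mpoly_eval f x = 0"
  then show "\<forall>y\<in>wclass w x. mpoly_eval f y = 0"
    using assms by (auto simp: whom_polys_iff mem_wclass mpoly_eval_wact_hom)
qed

lemma wp_zeros_iff:
  assumes "S \<subseteq> whom_polys I w" "x \<in> punctured I"
  shows "wclass w x \<in> wp_zeros I w S \<longleftrightarrow> (\<forall>f\<in>S. mpoly_eval f x = 0)"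
  using assms wclass_in_WP[OF assms(2)] whom_polys_vanish[of _ I w x]
  unfolding wp_zeros_def by blast

lemma whom_polys_one: "1 \<in> whom_polys I w"
  using hom_polys_one by (auto simp: whom_polys_iff)

lemma whom_polys_polys_in: "whom_polys I w \<subseteq> polys_in I"
  by (auto simp: whom_polys_def)

lemma openin_wp:
  "openin (wp_topology I w) U \<longleftrightarrow> (\<exists>S\<subseteq>whom_polys I w. U = WP I w - wp_zeros I w S)"
proof -
  have zeros: "wp_zeros I w S = {P \<in> WP I w. \<forall>f\<in>S. \<forall>x\<in>P. mpoly_eval f x = 0}" for S
    by (auto simp: wp_zeros_def)
  have "istopology (\<lambda>U. \<exists>S\<subseteq>whom_polys I w. U = WP I w - wp_zeros I w S)"
    unfolding zeros
  proof (rule istopology_zero_complements)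
    fix f g :: "('a, complex) mpoly"
    assume fg: "f \<in> whom_polys I w" "g \<in> whom_polys I w"
    then have "f * g \<in> whom_polys I w" by (rule whom_polys_mult)
    moreover have "(\<forall>x\<in>P. mpoly_eval (f * g) x = 0) \<longleftrightarrow>
        (\<forall>x\<in>P. mpoly_eval f x = 0) \<or> (\<forall>x\<in>P. mpoly_eval g x = 0)" if P_in: "P \<in> WP I w" for P
    proof -
      obtain x where P: "P = wclass w x" using P_in by (auto simp: WP_punctured)
      show ?thesis
        unfolding P whom_polys_vanish[OF fg(1)] whom_polys_vanish[OF fg(2)]
          whom_polys_vanish[OF \<open>f * g \<in> whom_polys I w\<close>]
        by (simp add: mpoly_eval_mult)
    qed
    ultimately show "\<exists>h\<in>whom_polys I w. \<forall>P\<in>WP I w. (\<forall>x\<in>P. mpoly_eval h x = 0) \<longleftrightarrow>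
        (\<forall>x\<in>P. mpoly_eval f x = 0) \<or> (\<forall>x\<in>P. mpoly_eval g x = 0)"
      by blast
  qed
  then show ?thesis by (simp add: wp_topology_def)
qed

lemma topspace_wp: "topspace (wp_topology I w) = WP I w"
proof
  show "topspace (wp_topology I w) \<subseteq> WP I w"
    unfolding topspace_def openin_wp by blast
  have "wp_zeros I w {1} = {}"
    using wclass_self by (fastforce simp: wp_zeros_def WP_punctured)
  then have "openin (wp_topology I w) (WP I w)"
    unfolding openin_wp using whom_polys_one by (intro exI[of _ "{1}"]) auto
  then show "WP I w \<subseteq> topspace (wp_topology I w)" by (rule openin_subset)
qed

text \<open>The topology of weighted projective space is the quotient topology: a set is open as soon as
  its preimage is open for arbitrary polynomials. If \<open>p\<close> does not vanish somewhere on an orbit, then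
  some weighted homogeneous part of \<open>p\<close> is nonzero on the whole orbit, and conversely.\<close>

lemma openin_wp_iff:
  assumes "U \<subseteq> WP I w"
  shows "openin (wp_topology I w) U \<longleftrightarrow>
    (\<exists>S\<subseteq>polys_in I. \<forall>x\<in>punctured I. wclass w x \<in> U \<longleftrightarrow> (\<exists>f\<in>S. mpoly_eval f x \<noteq> 0))"
proof
  assume "openin (wp_topology I w) U"
  then obtain S where S: "S \<subseteq> whom_polys I w" "U = WP I w - wp_zeros I w S"
    unfolding openin_wp by blast
  then have "\<forall>x\<in>punctured I. wclass w x \<in> U \<longleftrightarrow> (\<exists>f\<in>S. mpoly_eval f x \<noteq> 0)"
    using wp_zeros_iff[OF S(1)] wclass_in_WP[of _ I w] by auto
  then show "\<exists>S\<subseteq>polys_in I. \<forall>x\<in>punctured I. wclass w x \<in> U \<longleftrightarrow> (\<exists>f\<in>S. mpoly_eval f x \<noteq> 0)"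
    using subset_trans[OF S(1) whom_polys_polys_in] by (intro exI[of _ S] conjI)
next
  assume "\<exists>S\<subseteq>polys_in I. \<forall>x\<in>punctured I. wclass w x \<in> U \<longleftrightarrow> (\<exists>f\<in>S. mpoly_eval f x \<noteq> 0)"
  then obtain S where S: "S \<subseteq> polys_in I"
    and US: "\<And>x. x \<in> punctured I \<Longrightarrow> wclass w x \<in> U \<longleftrightarrow> (\<exists>f\<in>S. mpoly_eval f x \<noteq> 0)"
    by blast
  let ?H = "{hom_part w e f | e f. f \<in> S}"
  have H: "?H \<subseteq> whom_polys I w"
    using hom_part_in S unfolding whom_polys_iff subset_iff by blast
  have "wclass w x \<in> U \<longleftrightarrow> wclass w x \<notin> wp_zeros I w ?H" if x: "x \<in> punctured I" for x
  proof
    assume "wclass w x \<in> U"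
    then obtain f where "f \<in> S" "mpoly_eval f x \<noteq> 0" using US x by blast
    then show "wclass w x \<notin> wp_zeros I w ?H"
      unfolding wp_zeros_iff[OF H x] using hom_part_nonzero[of f x w] by blast
  next
    assume "wclass w x \<notin> wp_zeros I w ?H"
    then obtain e f where "f \<in> S" and nz: "mpoly_eval (hom_part w e f) x \<noteq> 0"
      unfolding wp_zeros_iff[OF H x] by blast
    moreover obtain t where "t \<noteq> 0" "mpoly_eval f (wact w t x) \<noteq> 0"
      using nonzero_on_orbit[OF nz] by blast
    ultimately show "wclass w x \<in> U"
      using US[of "wact w t x"] x by (auto simp: wclass_wact wact_punctured)
  qed
  then have "U = WP I w - wp_zeros I w ?H"
    using assms by (auto simp: WP_punctured)
  then show "openin (wp_topology I w) U"
    unfolding openin_wp using H by blast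
qed

text \<open>The regular functions of weighted projective space are the invariant regular functions
  upstairs. A local fraction \<open>f / g\<close> that represents an invariant function may be replaced by the
  fraction of the parts of \<open>f\<close> and \<open>g\<close> in one degree where the latter part does not vanish at the
  given point; the neighbourhood \<open>p \<noteq> 0\<close> is made invariant in the same way.\<close>

lemma wp_regular_iff:
  assumes U: "openin (wp_topology I w) U"
  shows "wp_regular I w U h \<longleftrightarrow>
    (\<forall>x\<in>punctured I. wclass w x \<in> U \<longrightarrow>
      (\<exists>p\<in>polys_in I. \<exists>f\<in>polys_in I. \<exists>g\<in>polys_in I. mpoly_eval p x \<noteq> 0 \<and>
        (\<forall>y\<in>punctured I. mpoly_eval p y \<noteq> 0 \<longrightarrow> wclass w y \<in> U \<and> mpoly_eval g y \<noteq> 0 \<and>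
          h (wclass w y) = mpoly_eval f y / mpoly_eval g y)))"
    (is "_ \<longleftrightarrow> (\<forall>x\<in>_. _ \<longrightarrow> ?loc x)")
proof (intro iffI ballI impI)
  fix x assume reg: "wp_regular I w U h" and x: "x \<in> punctured I" "wclass w x \<in> U"
  obtain U' f g where fg: "f \<in> polys_in I" "g \<in> polys_in I"
    and U': "openin (wp_topology I w) U'" "wclass w x \<in> U'" "U' \<subseteq> U"
    and h: "\<And>Q y. Q \<in> U' \<Longrightarrow> y \<in> Q \<Longrightarrow> mpoly_eval g y \<noteq> 0 \<and> h Q = mpoly_eval f y / mpoly_eval g y"
    using bspec[OF reg[unfolded wp_regular_def] x(2)] by blast
  have sub: "U' \<subseteq> WP I w" using openin_subset[OF U'(1)] by (simp add: topspace_wp)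
  obtain S where S: "S \<subseteq> polys_in I"
    and US_all: "\<forall>y\<in>punctured I. wclass w y \<in> U' \<longleftrightarrow> (\<exists>f\<in>S. mpoly_eval f y \<noteq> 0)"
    using iffD1[OF openin_wp_iff[OF sub] U'(1)] by blast
  note US = bspec[OF US_all]
  obtain p where "p \<in> S" "mpoly_eval p x \<noteq> 0" using US x U' by blast
  moreover have "wclass w y \<in> U \<and> mpoly_eval g y \<noteq> 0 \<and> h (wclass w y) = mpoly_eval f y / mpoly_eval g y"
    if "y \<in> punctured I" "mpoly_eval p y \<noteq> 0" for y
    using US[OF that(1)] that(2) \<open>p \<in> S\<close> h[of "wclass w y" y] wclass_self U'(3) by blast
  ultimately show "?loc x" using S fg by blast
next
  assume loc: "\<forall>x\<in>punctured I. wclass w x \<in> U \<longrightarrow> ?loc x"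
  show "wp_regular I w U h"
    unfolding wp_regular_def
  proof
    fix P assume P: "P \<in> U"
    then obtain x where x: "x \<in> punctured I" "P = wclass w x"
      using openin_subset[OF U] by (auto simp: topspace_wp WP_punctured)
    then have "?loc x" using loc P by simp
    then obtain p f g where pfg: "p \<in> polys_in I" "f \<in> polys_in I" "g \<in> polys_in I"
      and px: "mpoly_eval p x \<noteq> 0"
      and h: "\<And>y. y \<in> punctured I \<Longrightarrow> mpoly_eval p y \<noteq> 0 \<Longrightarrow> wclass w y \<in> U \<and>
        mpoly_eval g y \<noteq> 0 \<and> h (wclass w y) = mpoly_eval f y / mpoly_eval g y"
      by blast
    obtain d where d: "mpoly_eval (hom_part w d p) x \<noteq> 0"
      using hom_part_nonzero[OF px] by blast
    have "mpoly_eval g x \<noteq> 0" using h x px by blast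
    then obtain e where e: "mpoly_eval (hom_part w e g) x \<noteq> 0"
      using hom_part_nonzero by blast
    \<comment> \<open>where \<open>?q\<close> does not vanish, the orbit meets \<open>p \<noteq> 0\<close> and the new denominator is nonzero\<close>
    let ?q = "hom_part w d p * hom_part w e g" and ?f = "hom_part w e f" and ?g = "hom_part w e g"
    have hom: "?f \<in> hom_polys I w e" "?g \<in> hom_polys I w e" "?q \<in> hom_polys I w (d + e)"
      using pfg by (auto intro: hom_part_in hom_polys_mult)
    then have q: "{?q} \<subseteq> whom_polys I w" by (auto simp: whom_polys_iff)
    define U' where "U' = WP I w - wp_zeros I w {?q}"
    have U'_iff: "wclass w y \<in> U' \<longleftrightarrow> mpoly_eval (hom_part w d p) y \<noteq> 0 \<and> mpoly_eval ?g y \<noteq> 0"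
      if "y \<in> punctured I" for y
      using that wp_zeros_iff[OF q that] wclass_in_WP[OF that]
      by (simp add: U'_def mpoly_eval_mult)
    have main: "wclass w y \<in> U \<and> mpoly_eval ?g y \<noteq> 0 \<and> h (wclass w y) = mpoly_eval ?f y / mpoly_eval ?g y"
      if y: "y \<in> punctured I" "wclass w y \<in> U'" for y
    proof -
      \<comment> \<open>the given fraction is only known where \<open>p \<noteq> 0\<close>, so compare at a point \<open>t y\<close> of the orbit
        lying there; equal degrees make the quotient of the parts the same at \<open>y\<close>\<close>
      have nz: "mpoly_eval (hom_part w d p) y \<noteq> 0" "mpoly_eval ?g y \<noteq> 0" using U'_iff y by auto
      obtain t where t: "t \<noteq> 0" "mpoly_eval p (wact w t y) \<noteq> 0"
        using nonzero_on_orbit[OF nz(1)] by blast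
      have "mpoly_eval f (wact w a (wact w t y)) = h (wclass w y) * mpoly_eval g (wact w a (wact w t y))"
        if "a \<noteq> 0" "mpoly_eval p (wact w a (wact w t y)) \<noteq> 0" for a
        using h[of "wact w a (wact w t y)"] that t(1) y(1)
        by (simp add: wact_punctured wclass_wact)
      then have "mpoly_eval ?f (wact w t y) = h (wclass w y) * mpoly_eval ?g (wact w t y)"
        by (rule hom_part_proportional[OF t(2)])
      then have "mpoly_eval ?f y = h (wclass w y) * mpoly_eval ?g y"
        using t(1) by (simp add: mpoly_eval_wact_hom[OF hom(1)] mpoly_eval_wact_hom[OF hom(2)])
      then show ?thesis
        using nz h[of "wact w t y"] t y(1) by (simp add: wact_punctured wclass_wact)
    qed
    have "openin (wp_topology I w) U'" unfolding openin_wp U'_def using q by blast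
    moreover have "P \<in> U'" using U'_iff x d e by blast
    moreover have "U' \<subseteq> U" using main by (auto simp: U'_def WP_punctured)
    moreover have "mpoly_eval ?g y \<noteq> 0 \<and> h Q = mpoly_eval ?f y / mpoly_eval ?g y"
      if "Q \<in> U'" "y \<in> Q" for Q y
    proof -
      have "Q \<in> WP I w" using that by (auto simp: U'_def)
      then have "y \<in> punctured I" "Q = wclass w y" using mem_WP_elim that by blast+
      then show ?thesis using main[of y] that by simp
    qed
    ultimately show "\<exists>U' e. \<exists>f\<in>polys_in I. \<exists>g\<in>polys_in I. openin (wp_topology I w) U' \<and>
        P \<in> U' \<and> U' \<subseteq> U \<and> whomogeneous w e f \<and> whomogeneous w e g \<and>
        (\<forall>Q\<in>U'. \<forall>x\<in>Q. mpoly_eval g x \<noteq> 0 \<and> h Q = mpoly_eval f x / mpoly_eval g x)"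
      using hom unfolding hom_polys_def by blast
  qed
qed

section \<open>Triples and their coordinates\<close>

text \<open>All three spaces of polynomials consist of the polynomials supported on such a finite set, so
  their dimensions and coordinates can be treated uniformly.\<close>

definition exponents :: "component \<Rightarrow> nat \<Rightarrow> nat \<Rightarrow> nat \<Rightarrow> nat \<Rightarrow> nat \<Rightarrow> (nat \<times> nat) set" where
  "exponents X r s d1 d2 d3 = {ij. (X, ij) \<in> coords r s d1 d2 d3}"

lemma component_UNIV: "UNIV = {In_A, In_B, In_L}"
  using component.exhaust by auto

lemma finite_coords: "finite (coords r s d1 d2 d3)"
proof -
  have "coords r s d1 d2 d3 \<subseteq> UNIV \<times> {..max d1 (max d2 d3)} \<times> {..max d1 (max d2 d3)}"
    by (auto simp: coords_def)
  moreover have "finite (UNIV :: component set)" by (simp add: component_UNIV)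
  ultimately show ?thesis by (meson finite_SigmaI finite_atMost finite_subset)
qed

lemma coords_exponents: "coords r s d1 d2 d3 = Sigma UNIV (\<lambda>X. exponents X r s d1 d2 d3)"
  by (auto simp: exponents_def)

lemma finite_exponents: "finite (exponents X r s d1 d2 d3)"
proof -
  have "exponents X r s d1 d2 d3 \<subseteq> snd ` coords r s d1 d2 d3"
    by (force simp: exponents_def)
  then show ?thesis using finite_coords finite_subset by blast
qed

lemma total_degree_le: "total_degree p \<le> d \<longleftrightarrow> (\<forall>(i, j)\<in>Poly_Mapping.keys p. i + j \<le> d)"
  by (auto simp: total_degree_def)

lemma poly_mapping_expand:
  "(\<Sum>k\<in>Poly_Mapping.keys p. cscale (Poly_Mapping.lookup p k) (Poly_Mapping.single k 1)) = p"
  by (rule poly_mapping_eqI)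
    (auto simp: lookup_sum lookup_cscale lookup_single when_def in_keys_iff sum.delta' if_distrib
      cong: if_cong)

lemma span_monomials:
  "bpoly.span ((\<lambda>k. Poly_Mapping.single k 1) ` K) = {p. Poly_Mapping.keys p \<subseteq> K}"
proof
  show "bpoly.span ((\<lambda>k. Poly_Mapping.single k 1) ` K) \<subseteq> {p. Poly_Mapping.keys p \<subseteq> K}"
  proof (rule bpoly.span_minimal)
    show "bpoly.subspace {p. Poly_Mapping.keys p \<subseteq> K}"
      unfolding bpoly.subspace_def
    proof (intro conjI ballI allI)
      fix p q :: "complex bpoly" and c
      assume pq: "p \<in> {p. Poly_Mapping.keys p \<subseteq> K}" "q \<in> {p. Poly_Mapping.keys p \<subseteq> K}"
      then show "p + q \<in> {p. Poly_Mapping.keys p \<subseteq> K}"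
        using keys_add[of p q] by blast
      have "Poly_Mapping.keys (cscale c p) \<subseteq> Poly_Mapping.keys p"
        by (auto simp: in_keys_iff lookup_cscale)
      then show "cscale c p \<in> {p. Poly_Mapping.keys p \<subseteq> K}"
        using pq by blast
    qed simp
  qed auto
next
  show "{p. Poly_Mapping.keys p \<subseteq> K} \<subseteq> bpoly.span ((\<lambda>k. Poly_Mapping.single k 1) ` K)"
  proof
    fix p :: "complex bpoly" assume "p \<in> {p. Poly_Mapping.keys p \<subseteq> K}"
    then have "(\<Sum>k\<in>Poly_Mapping.keys p. cscale (Poly_Mapping.lookup p k) (Poly_Mapping.single k 1))
        \<in> bpoly.span ((\<lambda>k. Poly_Mapping.single k 1) ` K)"
      by (intro bpoly.span_sum bpoly.span_scale bpoly.span_base) auto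
    then show "p \<in> bpoly.span ((\<lambda>k. Poly_Mapping.single k 1) ` K)"
      by (simp add: poly_mapping_expand)
  qed
qed

text \<open>The monomials with exponents in \<open>K\<close> are a basis: the span of the other monomials consists of
  polynomials supported off a given exponent, hence does not contain its monomial.\<close>

lemma dim_supported:
  assumes "finite K"
  shows "bpoly.dim {p. Poly_Mapping.keys p \<subseteq> K} = card K"
proof -
  let ?m = "\<lambda>k. Poly_Mapping.single k (1 :: complex)"
  have inj: "inj_on ?m K" by (auto simp: inj_on_def poly_mapping_eq_iff fun_eq_iff lookup_single when_def)
  have "bpoly.independent (?m ` K)"
    unfolding bpoly.dependent_def
  proof safe
    fix k assume k: "k \<in> K" "?m k \<in> bpoly.span (?m ` K - {?m k})"
    have "?m ` K - {?m k} \<subseteq> ?m ` (K - {k})" by auto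
    then have "?m k \<in> bpoly.span (?m ` (K - {k}))"
      using k(2) bpoly.span_mono by blast
    then show False unfolding span_monomials by simp
  qed
  then have "bpoly.dim (bpoly.span (?m ` K)) = card K"
    using card_image[OF inj] bpoly.dim_eq_card[OF bpoly.span_span[symmetric]] by simp
  then show ?thesis by (simp only: span_monomials)
qed

lemma V_A_deg_supported: "V_A_deg r s d1 = {p. Poly_Mapping.keys p \<subseteq> exponents In_A r s d1 d2 d3}"
proof -
  have "{bmonom i j 1 | i j. r * i + s * j \<ge> s} =
      (\<lambda>k. Poly_Mapping.single k (1 :: complex)) ` {(i, j). r * i + s * j \<ge> s}"
    by auto
  then show ?thesis
    by (auto simp: V_A_deg_def V_A_def span_monomials total_degree_le exponents_def coords_def)
qed

lemma V_B_deg_supported: "V_B_deg r s d2 = {p. Poly_Mapping.keys p \<subseteq> exponents In_B r s d1 d2 d3}"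
proof -
  have "{bmonom i j 1 | i j. r * i + s * j \<ge> r} =
      (\<lambda>k. Poly_Mapping.single k (1 :: complex)) ` {(i, j). r * i + s * j \<ge> r}"
    by auto
  then show ?thesis
    by (auto simp: V_B_deg_def V_B_def span_monomials total_degree_le exponents_def coords_def)
qed

lemma V_L_deg_supported: "V_L_deg d3 = {p. Poly_Mapping.keys p \<subseteq> exponents In_L r s d1 d2 d3}"
  by (auto simp: V_L_deg_def total_degree_le exponents_def coords_def)

lemma card_coords:
  "card (coords r s d1 d2 d3) =
    bpoly.dim (V_A_deg r s d1) + bpoly.dim (V_B_deg r s d2) + bpoly.dim (V_L_deg d3)"
proof -
  have "card (coords r s d1 d2 d3) = (\<Sum>X\<in>UNIV. card (exponents X r s d1 d2 d3))"
    unfolding coords_exponents by (rule card_SigmaI) (auto simp: component_UNIV finite_exponents)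
  then show ?thesis
    by (simp add: component_UNIV dim_supported finite_exponents
        V_A_deg_supported[of r s d1 d2 d3] V_B_deg_supported[of r s d2 d1 d3]
        V_L_deg_supported[of d3 r s d1 d2])
qed

lemma mem_triples:
  "(A, B, L) \<in> triples r s d1 d2 d3 \<longleftrightarrow> Poly_Mapping.keys A \<subseteq> exponents In_A r s d1 d2 d3 \<and>
    Poly_Mapping.keys B \<subseteq> exponents In_B r s d1 d2 d3 \<and>
    Poly_Mapping.keys L \<subseteq> exponents In_L r s d1 d2 d3"
  by (simp add: triples_def V_A_deg_supported[of r s d1 d2 d3] V_B_deg_supported[of r s d2 d1 d3]
      V_L_deg_supported[of d3 r s d1 d2])

lemma coord_vec_simps [simp]:
  "coord_vec (A, B, L) (In_A, ij) = Poly_Mapping.lookup A ij"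
  "coord_vec (A, B, L) (In_B, ij) = Poly_Mapping.lookup B ij"
  "coord_vec (A, B, L) (In_L, ij) = Poly_Mapping.lookup L ij"
  by (simp_all add: coord_vec_def)

text \<open>Injectivity holds on all triples, not just on those of bounded degree. Taking images
  therefore separates sets of triples, in particular orbits.\<close>

lemma inj_coord_vec: "inj coord_vec"
proof (rule injI)
  fix T T' assume eq: "coord_vec T = coord_vec T'"
  obtain A B L A' B' L' where T: "T = (A, B, L)" "T' = (A', B', L')"
    using prod_cases3 by metis
  have "Poly_Mapping.lookup A ij = Poly_Mapping.lookup A' ij"
    "Poly_Mapping.lookup B ij = Poly_Mapping.lookup B' ij"
    "Poly_Mapping.lookup L ij = Poly_Mapping.lookup L' ij" for ij
    using fun_cong[OF eq, of "(In_A, ij)"] fun_cong[OF eq, of "(In_B, ij)"]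
      fun_cong[OF eq, of "(In_L, ij)"] by (simp_all add: T)
  then show "T = T'" by (auto simp: T intro: poly_mapping_eqI)
qed

text \<open>Membership of a triple and membership of its coordinate vector are the same condition. Every
  condition on triples can thus be moved to affine space and back.\<close>

lemma coord_vec_affine: "T \<in> triples r s d1 d2 d3 \<longleftrightarrow> coord_vec T \<in> affine_space (coords r s d1 d2 d3)"
proof -
  obtain A B L where T: "T = (A, B, L)" using prod_cases3 by metis
  have split: "(\<forall>X. P X) \<longleftrightarrow> P In_A \<and> P In_B \<and> P In_L" for P
    using component.exhaust by metis
  have keys: "Poly_Mapping.keys p \<subseteq> exponents X r s d1 d2 d3 \<longleftrightarrow>
      (\<forall>ij. (X, ij) \<notin> coords r s d1 d2 d3 \<longrightarrow> Poly_Mapping.lookup p ij = 0)" for p :: "complex bpoly" and X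
    by (auto simp: exponents_def in_keys_iff)
  have "x \<in> affine_space (coords r s d1 d2 d3) \<longleftrightarrow>
      (\<forall>X ij. (X, ij) \<notin> coords r s d1 d2 d3 \<longrightarrow> x (X, ij) = 0)" for x
    by (auto simp: affine_space_def)
  then show ?thesis
    unfolding T mem_triples keys split coord_vec_simps by simp
qed

lemma coord_vec_surj:
  assumes "x \<in> affine_space (coords r s d1 d2 d3)"
  obtains T where "coord_vec T = x"
proof -
  define c where "c X = Abs_poly_mapping (\<lambda>ij. x (X, ij))" for X
  have "finite {ij. x (X, ij) \<noteq> 0}" for X
  proof (rule finite_subset[OF _ finite_exponents])
    show "{ij. x (X, ij) \<noteq> 0} \<subseteq> exponents X r s d1 d2 d3"
      using assms by (auto simp: affine_space_def exponents_def)
  qed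
  then have c: "Poly_Mapping.lookup (c X) ij = x (X, ij)" for X ij by (simp add: c_def)
  have "coord_vec (c In_A, c In_B, c In_L) k = x k" for k
  proof -
    obtain X ij where k: "k = (X, ij)" by (rule prod.exhaust)
    show ?thesis by (cases X) (simp_all add: k c)
  qed
  then show ?thesis using that by blast
qed

lemma coord_vec_zero: "coord_vec (0, 0, 0) = (\<lambda>_. 0)"
proof
  fix k :: coord
  obtain X ij where k: "k = (X, ij)" by (rule prod.exhaust)
  show "coord_vec (0, 0, 0) k = 0" by (cases X) (simp_all add: k)
qed

lemma coord_vec_punctured:
  "T \<in> punctured_triples r s d1 d2 d3 \<longleftrightarrow> coord_vec T \<in> punctured (coords r s d1 d2 d3)"
  using coord_vec_affine[of T] inj_eq[OF inj_coord_vec, of T "(0, 0, 0)"]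
  by (auto simp: punctured_triples_def punctured_def coord_vec_zero)

lemma coord_vec_image_punctured:
  "coord_vec ` punctured_triples r s d1 d2 d3 = punctured (coords r s d1 d2 d3)"
proof (intro equalityI subsetI)
  fix x assume x: "x \<in> punctured (coords r s d1 d2 d3)"
  then have "x \<in> affine_space (coords r s d1 d2 d3)" by (simp add: punctured_def)
  then obtain T where "coord_vec T = x" by (rule coord_vec_surj)
  then show "x \<in> coord_vec ` punctured_triples r s d1 d2 d3"
    using x coord_vec_punctured by blast
qed (use coord_vec_punctured in blast)

section \<open>The quotient by the multiplicative group\<close>

lemma lookup_twist:
  "Poly_Mapping.lookup (twist t p) (i, j) = t ^ (1 + i + j) * Poly_Mapping.lookup p (i, j)"
  by (auto simp: twist_def lookup_mapp when_def in_keys_iff)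

lemma coord_vec_gm_act: "coord_vec (gm_act t T) = wact weight t (coord_vec T)"
proof
  fix k :: coord
  obtain A B L where T: "T = (A, B, L)" using prod_cases3 by metis
  obtain X i j where k: "k = (X, i, j)" using prod_cases3 by metis
  show "coord_vec (gm_act t T) k = wact weight t (coord_vec T) k"
    by (cases X) (simp_all add: T k gm_act_def wact_def weight_def lookup_twist)
qed

lemma coord_vec_orbit: "coord_vec ` gm_orbit T = wclass weight (coord_vec T)"
  by (auto simp: gm_orbit_def wclass_def coord_vec_gm_act[symmetric])

lemma coord_vec_orbit_eq_iff:
  "coord_vec ` gm_orbit T = coord_vec ` gm_orbit T' \<longleftrightarrow> gm_orbit T = gm_orbit T'"
  using inj_image_eq_iff[OF inj_coord_vec] .

lemma openin_punctured:
  "openin (punctured_topology r s d1 d2 d3) V \<longleftrightarrow> (\<exists>S\<subseteq>polys_in (coords r s d1 d2 d3).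
    V = {T \<in> punctured_triples r s d1 d2 d3. \<exists>f\<in>S. mpoly_eval f (coord_vec T) \<noteq> 0})"
proof -
  let ?I = "coords r s d1 d2 d3"
  have pre: "coord_vec -` (affine_space ?I - {x \<in> affine_space ?I. \<forall>f\<in>S. mpoly_eval f x = 0}) \<inter>
      punctured_triples r s d1 d2 d3 =
      {T \<in> punctured_triples r s d1 d2 d3. \<exists>f\<in>S. mpoly_eval f (coord_vec T) \<noteq> 0}" for S
    using coord_vec_affine by (auto simp: punctured_triples_def)
  then show ?thesis
    unfolding punctured_topology_def openin_pullback_topology openin_affine pre[symmetric] by blast
qed

lemma topspace_punctured:
  "topspace (punctured_topology r s d1 d2 d3) = punctured_triples r s d1 d2 d3"
  using coord_vec_affine
  by (auto simp: punctured_topology_def topspace_pullback_topology topspace_affine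
      punctured_triples_def)

text \<open>A neighbourhood in the definition of a regular function may be taken to be the locus where a
  single polynomial does not vanish. This puts regularity upstairs in the same form as
  \<open>wp_regular_iff\<close>.\<close>

lemma punctured_regular_iff:
  assumes "V \<subseteq> punctured_triples r s d1 d2 d3"
  shows "punctured_regular r s d1 d2 d3 V H \<longleftrightarrow>
    (\<forall>T\<in>V. \<exists>p\<in>polys_in (coords r s d1 d2 d3). \<exists>f\<in>polys_in (coords r s d1 d2 d3).
      \<exists>g\<in>polys_in (coords r s d1 d2 d3). mpoly_eval p (coord_vec T) \<noteq> 0 \<and>
      (\<forall>T'\<in>punctured_triples r s d1 d2 d3. mpoly_eval p (coord_vec T') \<noteq> 0 \<longrightarrow> T' \<in> V \<and>
        mpoly_eval g (coord_vec T') \<noteq> 0 \<and>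
        H T' = mpoly_eval f (coord_vec T') / mpoly_eval g (coord_vec T')))"
    (is "_ \<longleftrightarrow> (\<forall>T\<in>V. ?loc T)")
  unfolding punctured_regular_def
proof (intro ball_cong refl iffI)
  let ?PT = "punctured_triples r s d1 d2 d3"
  let ?ok = "\<lambda>f g T'. mpoly_eval g (coord_vec T') \<noteq> 0 \<and>
        H T' = mpoly_eval f (coord_vec T') / mpoly_eval g (coord_vec T')"
  fix T assume T: "T \<in> V"
  {
    assume "\<exists>U'. \<exists>f\<in>polys_in (coords r s d1 d2 d3). \<exists>g\<in>polys_in (coords r s d1 d2 d3).
      openin (punctured_topology r s d1 d2 d3) U' \<and> T \<in> U' \<and> U' \<subseteq> V \<and> (\<forall>T'\<in>U'. ?ok f g T')"
    then obtain U' f g where fg: "f \<in> polys_in (coords r s d1 d2 d3)" "g \<in> polys_in (coords r s d1 d2 d3)"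
      and U': "openin (punctured_topology r s d1 d2 d3) U'" "T \<in> U'" "U' \<subseteq> V"
      and ok: "\<forall>T'\<in>U'. ?ok f g T'"
      by blast
    obtain S where S: "S \<subseteq> polys_in (coords r s d1 d2 d3)"
      "U' = {T \<in> ?PT. \<exists>f\<in>S. mpoly_eval f (coord_vec T) \<noteq> 0}"
      using U'(1) unfolding openin_punctured by blast
    obtain p where p: "p \<in> S" "mpoly_eval p (coord_vec T) \<noteq> 0"
      using U'(2) unfolding S(2) by blast
    have "T' \<in> U'" if "T' \<in> ?PT" "mpoly_eval p (coord_vec T') \<noteq> 0" for T'
      unfolding S(2) using that p(1) by blast
    then have "\<forall>T'\<in>?PT. mpoly_eval p (coord_vec T') \<noteq> 0 \<longrightarrow> T' \<in> V \<and> ?ok f g T'"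
      using ok U'(3) by blast
    moreover have "p \<in> polys_in (coords r s d1 d2 d3)" using p S by blast
    ultimately show "?loc T" using fg p(2) by blast
  }
  assume "?loc T"
  then obtain p f g where pfg: "p \<in> polys_in (coords r s d1 d2 d3)"
    "f \<in> polys_in (coords r s d1 d2 d3)" "g \<in> polys_in (coords r s d1 d2 d3)"
    and p: "mpoly_eval p (coord_vec T) \<noteq> 0"
    and ok: "\<forall>T'\<in>?PT. mpoly_eval p (coord_vec T') \<noteq> 0 \<longrightarrow> T' \<in> V \<and> ?ok f g T'"
    by blast
  let ?U = "{T \<in> ?PT. mpoly_eval p (coord_vec T) \<noteq> 0}"
  have "openin (punctured_topology r s d1 d2 d3) ?U"
    unfolding openin_punctured using pfg(1) by (intro exI[of _ "{p}"]) auto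
  moreover have "T \<in> ?U" "?U \<subseteq> V" "\<forall>T'\<in>?U. ?ok f g T'" using ok p T assms by auto
  ultimately show "\<exists>U'. \<exists>f\<in>polys_in (coords r s d1 d2 d3). \<exists>g\<in>polys_in (coords r s d1 d2 d3).
      openin (punctured_topology r s d1 d2 d3) U' \<and> T \<in> U' \<and> U' \<subseteq> V \<and> (\<forall>T'\<in>U'. ?ok f g T')"
    using pfg by blast
qed

lemma openin_quotient_topology:
  "openin (quotient_topology X q) U \<longleftrightarrow>
    U \<subseteq> q ` topspace X \<and> openin X {x \<in> topspace X. q x \<in> U}"
proof -
  have "istopology (\<lambda>U. U \<subseteq> q ` topspace X \<and> openin X {x \<in> topspace X. q x \<in> U})"
    unfolding istopology_def
  proof (intro conjI allI impI)
    fix U V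
    assume "U \<subseteq> q ` topspace X \<and> openin X {x \<in> topspace X. q x \<in> U}"
      "V \<subseteq> q ` topspace X \<and> openin X {x \<in> topspace X. q x \<in> V}"
    moreover have "{x \<in> topspace X. q x \<in> U \<inter> V} =
        {x \<in> topspace X. q x \<in> U} \<inter> {x \<in> topspace X. q x \<in> V}"
      by blast
    ultimately show "U \<inter> V \<subseteq> q ` topspace X" "openin X {x \<in> topspace X. q x \<in> U \<inter> V}"
      by auto
  next
    fix \<K> assume \<K>: "\<forall>U\<in>\<K>. U \<subseteq> q ` topspace X \<and> openin X {x \<in> topspace X. q x \<in> U}"
    have "{x \<in> topspace X. q x \<in> \<Union>\<K>} = (\<Union>U\<in>\<K>. {x \<in> topspace X. q x \<in> U})" by blast
    then show "openin X {x \<in> topspace X. q x \<in> \<Union>\<K>}" using \<K> by auto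
    show "\<Union>\<K> \<subseteq> q ` topspace X" using \<K> by blast
  qed
  then show ?thesis by (simp add: quotient_topology_def)
qed

lemma topspace_quotient_topology: "topspace (quotient_topology X q) = q ` topspace X"
proof
  show "topspace (quotient_topology X q) \<subseteq> q ` topspace X"
    unfolding topspace_def openin_quotient_topology by blast
  have "{x \<in> topspace X. q x \<in> q ` topspace X} = topspace X" by blast
  then have "openin (quotient_topology X q) (q ` topspace X)"
    unfolding openin_quotient_topology by simp
  then show "q ` topspace X \<subseteq> topspace (quotient_topology X q)" by (rule openin_subset)
qed

text \<open>Both sides have been described by the same conditions on polynomials at points of the punctured
  affine space, once for triples and once for classes of coordinate vectors. Since \<open>coord_vec\<close> is
  an equivariant bijection between the two, the descriptions agree.\<close>

lemma quotient_iso_WP: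
  "variety_iso
     (quotient_topology (punctured_topology r s d1 d2 d3) gm_orbit)
     (quotient_regular (punctured_topology r s d1 d2 d3) (punctured_regular r s d1 d2 d3) gm_orbit)
     (wp_topology (coords r s d1 d2 d3) weight) (wp_regular (coords r s d1 d2 d3) weight)
     (\<lambda>Orb. coord_vec ` Orb)"
proof -
  let ?I = "coords r s d1 d2 d3" and ?PT = "punctured_triples r s d1 d2 d3"
  let ?X = "punctured_topology r s d1 d2 d3"
  let ?Q = "quotient_topology ?X gm_orbit" and ?Y = "wp_topology ?I weight"
  have top: "topspace ?Q = gm_orbit ` ?PT"
    by (simp add: topspace_quotient_topology topspace_punctured)
  define V where "V U = {T \<in> ?PT. wclass weight (coord_vec T) \<in> U}" for U
  have pre: "{T \<in> ?PT. gm_orbit T \<in> {Orb \<in> gm_orbit ` ?PT. coord_vec ` Orb \<in> U}} = V U" for U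
    by (auto simp: V_def coord_vec_orbit)
  have surj: "(\<forall>x\<in>punctured ?I. Q x) \<longleftrightarrow> (\<forall>T\<in>?PT. Q (coord_vec T))" for Q
    unfolding coord_vec_image_punctured[symmetric] by blast
  have image: "(\<lambda>Orb. coord_vec ` Orb) ` gm_orbit ` ?PT = WP ?I weight"
    unfolding image_image coord_vec_orbit WP_punctured coord_vec_image_punctured[symmetric] ..
  have opens: "openin ?X (V U) \<longleftrightarrow> openin ?Y U" if "U \<subseteq> WP ?I weight" for U
  proof -
    have "openin ?X (V U) \<longleftrightarrow> (\<exists>S\<subseteq>polys_in ?I. \<forall>T\<in>?PT.
        wclass weight (coord_vec T) \<in> U \<longleftrightarrow> (\<exists>f\<in>S. mpoly_eval f (coord_vec T) \<noteq> 0))"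
      unfolding openin_punctured V_def by (intro ex_cong1 conj_cong refl) blast
    then show ?thesis unfolding openin_wp_iff[OF that] surj .
  qed
  have "homeomorphic_map ?Q ?Y (\<lambda>Orb. coord_vec ` Orb)"
    unfolding homeomorphic_map_def quotient_map_def top topspace_wp
  proof (intro conjI allI impI)
    fix U assume "U \<subseteq> WP ?I weight"
    then show "openin ?Q {Orb \<in> gm_orbit ` ?PT. coord_vec ` Orb \<in> U} \<longleftrightarrow> openin ?Y U"
      unfolding openin_quotient_topology topspace_punctured pre using opens by blast
  next
    show "inj_on (\<lambda>Orb. coord_vec ` Orb) (gm_orbit ` ?PT)"
      by (auto simp: inj_on_def coord_vec_orbit_eq_iff)
  qed (rule image)
  moreover have "wp_regular ?I weight U h \<longleftrightarrow>
      punctured_regular r s d1 d2 d3 (V U) (h \<circ> (\<lambda>Orb. coord_vec ` Orb) \<circ> gm_orbit)"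
    if "openin ?Y U" for U h
  proof -
    have VU: "V U \<subseteq> ?PT" by (auto simp: V_def)
    show ?thesis
      unfolding wp_regular_iff[OF that] punctured_regular_iff[OF VU] surj comp_def coord_vec_orbit
      by (auto simp: V_def)
  qed
  ultimately show ?thesis
    unfolding variety_iso_def quotient_regular_def top topspace_punctured pre by blast
qed

section \<open>The coefficients of mu\<close>

lemma lookup_du:
  "Poly_Mapping.lookup (du p) (i, j) = of_nat (Suc i) * Poly_Mapping.lookup p (Suc i, j)"
proof -
  have "Poly_Mapping.lookup (du p) (i, j) = (\<Sum>k\<in>Poly_Mapping.keys p.
      if k = (Suc i, j) then of_nat (Suc i) * Poly_Mapping.lookup p (Suc i, j) else 0)"
    unfolding du_def lookup_sum
  proof (rule sum.cong[OF refl])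
    fix k :: "nat \<times> nat"
    obtain a b where k: "k = (a, b)" by (rule prod.exhaust)
    show "Poly_Mapping.lookup (case k of (i, j) \<Rightarrow>
          bmonom (i - 1) j (of_nat i * Poly_Mapping.lookup p (i, j))) (i, j) =
        (if k = (Suc i, j) then of_nat (Suc i) * Poly_Mapping.lookup p (Suc i, j) else 0)"
      by (cases a) (auto simp: k lookup_single when_def)
  qed
  also have "\<dots> = of_nat (Suc i) * Poly_Mapping.lookup p (Suc i, j)"
    by (simp add: in_keys_iff)
  finally show ?thesis .
qed

lemma lookup_dv:
  "Poly_Mapping.lookup (dv p) (i, j) = of_nat (Suc j) * Poly_Mapping.lookup p (i, Suc j)"
proof -
  have "Poly_Mapping.lookup (dv p) (i, j) = (\<Sum>k\<in>Poly_Mapping.keys p.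
      if k = (i, Suc j) then of_nat (Suc j) * Poly_Mapping.lookup p (i, Suc j) else 0)"
    unfolding dv_def lookup_sum
  proof (rule sum.cong[OF refl])
    fix k :: "nat \<times> nat"
    obtain a b where k: "k = (a, b)" by (rule prod.exhaust)
    show "Poly_Mapping.lookup (case k of (i, j) \<Rightarrow>
          bmonom i (j - 1) (of_nat j * Poly_Mapping.lookup p (i, j))) (i, j) =
        (if k = (i, Suc j) then of_nat (Suc j) * Poly_Mapping.lookup p (i, Suc j) else 0)"
      by (cases b) (auto simp: k lookup_single when_def)
  qed
  also have "\<dots> = of_nat (Suc j) * Poly_Mapping.lookup p (i, Suc j)"
    by (simp add: in_keys_iff)
  finally show ?thesis .
qed

text \<open>The operations from which \<open>mu\<close> is built commute with a ring homomorphism applied to all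
  coefficients. Hence evaluating the coefficients of the generic \<open>mu\<close> at the coordinates of a triple
  gives the coefficients of the \<open>mu\<close> of that triple.\<close>

context coeff_hom
begin

definition coeff_image :: "('m \<Rightarrow>\<^sub>0 'a) \<Rightarrow> ('m \<Rightarrow>\<^sub>0 'b) \<Rightarrow> bool" where
  "coeff_image p q \<longleftrightarrow> (\<forall>k. Poly_Mapping.lookup q k = h (Poly_Mapping.lookup p k))"

lemma coeff_image_add: "coeff_image p p' \<Longrightarrow> coeff_image q q' \<Longrightarrow> coeff_image (p + q) (p' + q')"
  by (simp add: coeff_image_def lookup_add h_add)

lemma coeff_image_diff: "coeff_image p p' \<Longrightarrow> coeff_image q q' \<Longrightarrow> coeff_image (p - q) (p' - q')"
  by (simp add: coeff_image_def lookup_minus h_diff)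

lemma coeff_image_keys: "coeff_image p p' \<Longrightarrow> Poly_Mapping.keys p' \<subseteq> Poly_Mapping.keys p"
  by (auto simp: coeff_image_def in_keys_iff h_zero)

lemma coeff_image_mult:
  fixes p q :: "'m::monoid_add \<Rightarrow>\<^sub>0 'a"
  assumes "coeff_image p p'" "coeff_image q q'"
  shows "coeff_image (p * q) (p' * q')"
  using assms coeff_image_keys[OF assms(1)] coeff_image_keys[OF assms(2)]
  by (simp add: coeff_image_def h_sum h_when h_mult
      lookup_mult_finite[of "Poly_Mapping.keys p" "Poly_Mapping.keys q"])

lemma coeff_image_of_nat_mult:
  fixes p :: "'m::monoid_add \<Rightarrow>\<^sub>0 'a"
  shows "coeff_image p p' \<Longrightarrow> coeff_image (of_nat n * p) (of_nat n * p')"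
  by (simp add: coeff_image_def lookup_of_nat_mult h_mult h_of_nat)

lemma coeff_image_du: "coeff_image p p' \<Longrightarrow> coeff_image (du p) (du p')"
  by (simp add: coeff_image_def lookup_du h_mult h_of_nat del: of_nat_Suc)

lemma coeff_image_dv: "coeff_image p p' \<Longrightarrow> coeff_image (dv p) (dv p')"
  by (simp add: coeff_image_def lookup_dv h_mult h_of_nat del: of_nat_Suc)

lemma coeff_image_mu:
  assumes "coeff_image A A'" "coeff_image B B'" "coeff_image L L'"
  shows "coeff_image (mu r s A B L) (mu r s A' B' L')"
  unfolding mu_def bracket_def mult.assoc
  by (intro coeff_image_add coeff_image_of_nat_mult coeff_image_mult coeff_image_diff
      coeff_image_du coeff_image_dv assms)

end

lemma lookup_generic_poly:
  "Poly_Mapping.lookup (generic_poly X r s d1 d2 d3) ij =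
    (if (X, ij) \<in> coords r s d1 d2 d3 then mvar (X, ij) else 0)"
proof -
  have "{(i, j). (X, i, j) \<in> coords r s d1 d2 d3} = exponents X r s d1 d2 d3"
    by (auto simp: exponents_def)
  then have "Poly_Mapping.lookup (generic_poly X r s d1 d2 d3) ij =
      (\<Sum>k\<in>exponents X r s d1 d2 d3. if k = ij then mvar (X, ij) else 0)"
    unfolding generic_poly_def lookup_sum
    by (intro sum.cong) (auto simp: lookup_single when_def)
  also have "\<dots> = (if (X, ij) \<in> coords r s d1 d2 d3 then mvar (X, ij) else 0)"
    using finite_exponents[of X r s d1 d2 d3] by (simp add: exponents_def)
  finally show ?thesis .
qed

lemma generic_poly_specializes:
  assumes "x \<in> affine_space (coords r s d1 d2 d3)" "\<And>ij. Poly_Mapping.lookup p ij = x (X, ij)"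
  shows "int_eval.coeff_image x (generic_poly X r s d1 d2 d3) p"
  using assms by (auto simp: int_eval.coeff_image_def lookup_generic_poly int_eval_mvar
      int_eval.h_zero affine_space_def)

lemma lookup_mu:
  assumes "(A, B, L) \<in> triples r s d1 d2 d3"
  shows "Poly_Mapping.lookup (mu r s A B L) (i, j) =
    int_eval (coord_vec (A, B, L)) (mu_coeff r s d1 d2 d3 i j)"
proof -
  have "coord_vec (A, B, L) \<in> affine_space (coords r s d1 d2 d3)"
    using assms coord_vec_affine by blast
  then have "int_eval.coeff_image (coord_vec (A, B, L))
      (mu r s (generic_poly In_A r s d1 d2 d3) (generic_poly In_B r s d1 d2 d3)
        (generic_poly In_L r s d1 d2 d3)) (mu r s A B L)"
    by (intro int_eval.coeff_image_mu generic_poly_specializes) simp_all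
  then show ?thesis by (simp add: int_eval.coeff_image_def mu_coeff_def)
qed

text \<open>This is homogeneity of degree \<open>c\<close> when \<open>u\<close> and \<open>v\<close> are given degree \<open>-1\<close>, so shifts add up in
  products and a derivative raises the shift by one. The generic polynomials have shift \<open>1\<close>, so the
  products \<open>\<Lambda> B_u A_v\<close> etc. of which \<open>mu\<close> consists have shift \<open>1 + 2 + 2 = 5\<close>.\<close>

definition graded_shift :: "'k set \<Rightarrow> ('k \<Rightarrow> nat) \<Rightarrow> nat \<Rightarrow> ('k, int) mpoly bpoly \<Rightarrow> bool" where
  "graded_shift I w c p \<longleftrightarrow> (\<forall>i j. Poly_Mapping.lookup p (i, j) \<in> hom_polys I w (c + i + j))"

lemma graded_shift_add:
  "graded_shift I w c p \<Longrightarrow> graded_shift I w c q \<Longrightarrow> graded_shift I w c (p + q)"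
  by (simp add: graded_shift_def lookup_add hom_polys_add)

lemma graded_shift_diff:
  "graded_shift I w c p \<Longrightarrow> graded_shift I w c q \<Longrightarrow> graded_shift I w c (p - q)"
  by (simp add: graded_shift_def lookup_minus hom_polys_diff)

lemma graded_shift_of_nat_mult: "graded_shift I w c p \<Longrightarrow> graded_shift I w c (of_nat n * p)"
  by (simp add: graded_shift_def lookup_of_nat_mult hom_polys_of_nat_mult)

lemma graded_shift_mult:
  assumes p: "graded_shift I w c p" and q: "graded_shift I w d q" and e: "e = c + d"
  shows "graded_shift I w e (p * q)"
  unfolding graded_shift_def
proof (intro allI)
  fix i j
  have "(Poly_Mapping.lookup p a * Poly_Mapping.lookup q b when a + b = (i, j))
      \<in> hom_polys I w (e + i + j)" for a b
  proof (cases "a + b = (i, j)")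
    case True
    obtain a1 a2 b1 b2 where ab: "a = (a1, a2)" "b = (b1, b2)" by (metis prod.exhaust)
    have "Poly_Mapping.lookup p a * Poly_Mapping.lookup q b
        \<in> hom_polys I w ((c + a1 + a2) + (d + b1 + b2))"
      using p q unfolding ab graded_shift_def by (intro hom_polys_mult) auto
    moreover have "(c + a1 + a2) + (d + b1 + b2) = e + i + j"
      using True by (auto simp: ab e)
    ultimately show ?thesis using True by simp
  qed simp
  then show "Poly_Mapping.lookup (p * q) (i, j) \<in> hom_polys I w (e + i + j)"
    by (simp add: lookup_mult_finite[OF finite_keys finite_keys subset_refl subset_refl]
        hom_polys_sum)
qed

lemma graded_shift_du: "graded_shift I w c p \<Longrightarrow> graded_shift I w (Suc c) (du p)"
  unfolding graded_shift_def lookup_du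
  by (metis add_Suc add_Suc_right hom_polys_of_nat_mult)

lemma graded_shift_dv: "graded_shift I w c p \<Longrightarrow> graded_shift I w (Suc c) (dv p)"
  unfolding graded_shift_def lookup_dv
  by (metis add_Suc add_Suc_right hom_polys_of_nat_mult)

lemma graded_shift_bracket:
  assumes "graded_shift I w 1 f" "graded_shift I w 1 g"
  shows "graded_shift I w 4 (bracket f g)"
  unfolding bracket_def using assms
  by (intro graded_shift_diff graded_shift_mult[of _ _ "Suc 1" _ "Suc 1"]
      graded_shift_du graded_shift_dv) auto

lemma graded_shift_generic: "graded_shift (coords r s d1 d2 d3) weight 1 (generic_poly X r s d1 d2 d3)"
  unfolding graded_shift_def lookup_generic_poly
proof (intro allI)
  fix i j
  have "weight (X, i, j) = 1 + i + j" by (simp add: weight_def)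
  then show "(if (X, i, j) \<in> coords r s d1 d2 d3 then mvar (X, i, j) else 0)
      \<in> hom_polys (coords r s d1 d2 d3) weight (1 + i + j)"
    using hom_polys_mvar[of "(X, i, j)" "coords r s d1 d2 d3" weight] by auto
qed

lemma mu_coeff_hom:
  "mu_coeff r s d1 d2 d3 i j \<in> hom_polys (coords r s d1 d2 d3) weight (5 + i + j)"
proof -
  let ?A = "generic_poly In_A r s d1 d2 d3" and ?B = "generic_poly In_B r s d1 d2 d3"
    and ?L = "generic_poly In_L r s d1 d2 d3"
  have "graded_shift (coords r s d1 d2 d3) weight 5 (mu r s ?A ?B ?L)"
    unfolding mu_def mult.assoc
    by (intro graded_shift_add graded_shift_of_nat_mult graded_shift_mult[of _ _ 1 _ 4]
        graded_shift_generic graded_shift_bracket) auto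
  then show ?thesis by (simp add: graded_shift_def mu_coeff_def)
qed

section \<open>Well-formedness\<close>

text \<open>Besides the constant coefficient of \<open>\<Lambda>\<close>, which has weight \<open>1\<close>, the coefficients of \<open>v\<close> and
  \<open>v^2\<close> in \<open>A\<close> have the coprime weights \<open>2\<close> and \<open>3\<close>, so no single coordinate is responsible for
  the greatest common divisor being \<open>1\<close>.\<close>

lemma well_formed_coords:
  assumes "d1 \<ge> 2"
  shows "well_formed_weights (coords r s d1 d2 d3) weight"
  unfolding well_formed_weights_def
proof
  fix k
  let ?W = "weight ` (coords r s d1 d2 d3 - {k})"
  show "Gcd ?W = 1"
  proof (cases "k = (In_L, 0, 0)")
    case False
    then have "(In_L, 0, 0) \<in> coords r s d1 d2 d3 - {k}" by (simp add: coords_def)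
    then have "Gcd ?W dvd weight (In_L, 0, 0)" by (intro Gcd_dvd imageI)
    then show ?thesis by (simp add: weight_def)
  next
    case True
    then have "(In_A, 0, 1) \<in> coords r s d1 d2 d3 - {k}" "(In_A, 0, 2) \<in> coords r s d1 d2 d3 - {k}"
      using assms by (auto simp: coords_def)
    then have "Gcd ?W dvd weight (In_A, 0, 1)" "Gcd ?W dvd weight (In_A, 0, 2)"
      by (blast intro: Gcd_dvd)+
    then have "Gcd ?W dvd 2" "Gcd ?W dvd 3" by (simp_all add: weight_def numeral_2_eq_2 numeral_3_eq_3)
    then have "Gcd ?W dvd 3 - 2" by (intro dvd_diff_nat)
    then show ?thesis by simp
  qed
qed

section \<open>The Keller locus\<close>

text \<open>These conditions concern one representative, whereas \<open>W_locus\<close> asks for them at all points of a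
  class. The two agree because all polynomials involved are weighted homogeneous.\<close>

definition keller_conditions :: "nat \<Rightarrow> nat \<Rightarrow> nat \<Rightarrow> nat \<Rightarrow> nat \<Rightarrow> (coord \<Rightarrow> complex) \<Rightarrow> bool" where
  "keller_conditions r s d1 d2 d3 x \<longleftrightarrow>
    (\<forall>i j. (i, j) \<noteq> (0, 0) \<longrightarrow> int_eval x (mu_coeff r s d1 d2 d3 i j) = 0) \<and>
    int_eval x (mu_coeff r s d1 d2 d3 0 0) \<noteq> 0 \<and>
    (\<exists>i j. i + j \<ge> 1 \<and> (In_L, i, j) \<in> coords r s d1 d2 d3 \<and> x (In_L, i, j) \<noteq> 0)"

definition keller_equations :: "nat \<Rightarrow> nat \<Rightarrow> nat \<Rightarrow> nat \<Rightarrow> nat \<Rightarrow> (coord, int) mpoly set" where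
  "keller_equations r s d1 d2 d3 = {mu_coeff r s d1 d2 d3 i j | i j. (i, j) \<noteq> (0, 0)}"

text \<open>Both open conditions hold iff one of these products does not vanish.\<close>

definition keller_nonvanishing :: "nat \<Rightarrow> nat \<Rightarrow> nat \<Rightarrow> nat \<Rightarrow> nat \<Rightarrow> (coord, int) mpoly set" where
  "keller_nonvanishing r s d1 d2 d3 = {mu_coeff r s d1 d2 d3 0 0 * mvar (In_L, i, j) | i j.
     i + j \<ge> 1 \<and> (In_L, i, j) \<in> coords r s d1 d2 d3}"

text \<open>Although \<open>i\<close> and \<open>j\<close> are unbounded, almost all of the equations read \<open>0 = 0\<close>, because the
  generic \<open>mu\<close> has finite support.\<close>

lemma finite_keller_equations: "finite (keller_equations r s d1 d2 d3)"
proof -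
  let ?M = "mu r s (generic_poly In_A r s d1 d2 d3) (generic_poly In_B r s d1 d2 d3)
    (generic_poly In_L r s d1 d2 d3)"
  have "keller_equations r s d1 d2 d3 \<subseteq> insert 0 (Poly_Mapping.lookup ?M ` Poly_Mapping.keys ?M)"
  proof
    fix f assume "f \<in> keller_equations r s d1 d2 d3"
    then obtain ij where "f = Poly_Mapping.lookup ?M ij"
      unfolding keller_equations_def mu_coeff_def by blast
    then show "f \<in> insert 0 (Poly_Mapping.lookup ?M ` Poly_Mapping.keys ?M)"
      by (cases "ij \<in> Poly_Mapping.keys ?M") (simp_all add: in_keys_iff)
  qed
  then show ?thesis by (rule finite_subset) simp
qed

lemma finite_keller_nonvanishing: "finite (keller_nonvanishing r s d1 d2 d3)"
proof (rule finite_subset)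
  show "keller_nonvanishing r s d1 d2 d3 \<subseteq>
      (\<lambda>k. mu_coeff r s d1 d2 d3 0 0 * mvar k) ` coords r s d1 d2 d3"
    by (auto simp: keller_nonvanishing_def)
qed (simp add: finite_coords)

lemma keller_equations_whom: "keller_equations r s d1 d2 d3 \<subseteq> whom_polys (coords r s d1 d2 d3) weight"
  using mu_coeff_hom by (fastforce simp: keller_equations_def whom_polys_iff)

lemma keller_nonvanishing_whom:
  "keller_nonvanishing r s d1 d2 d3 \<subseteq> whom_polys (coords r s d1 d2 d3) weight"
proof
  fix f assume "f \<in> keller_nonvanishing r s d1 d2 d3"
  then obtain k where "f = mu_coeff r s d1 d2 d3 0 0 * mvar k" "k \<in> coords r s d1 d2 d3"
    unfolding keller_nonvanishing_def by blast
  then show "f \<in> whom_polys (coords r s d1 d2 d3) weight"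
    unfolding whom_polys_iff using hom_polys_mult[OF mu_coeff_hom hom_polys_mvar] by blast
qed

lemma base_change_whom: "S \<subseteq> whom_polys I w \<Longrightarrow> base_change ` S \<subseteq> whom_polys I w"
  unfolding whom_polys_iff subset_iff using base_change_hom_polys by blast

lemma keller_conditions_zeros:
  assumes x: "x \<in> punctured (coords r s d1 d2 d3)"
  shows "wclass weight x \<in>
      wp_zeros (coords r s d1 d2 d3) weight (base_change ` keller_equations r s d1 d2 d3) -
      wp_zeros (coords r s d1 d2 d3) weight (base_change ` keller_nonvanishing r s d1 d2 d3) \<longleftrightarrow>
    keller_conditions r s d1 d2 d3 x"
proof -
  let ?I = "coords r s d1 d2 d3"
  have eqs: "wclass weight x \<in> wp_zeros ?I weight (base_change ` keller_equations r s d1 d2 d3) \<longleftrightarrow>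
      (\<forall>i j. (i, j) \<noteq> (0, 0) \<longrightarrow> int_eval x (mu_coeff r s d1 d2 d3 i j) = 0)"
    unfolding wp_zeros_iff[OF base_change_whom[OF keller_equations_whom] x] int_eval_def
    by (auto simp: keller_equations_def)
  have product: "int_eval x (mu_coeff r s d1 d2 d3 0 0 * mvar k) \<noteq> 0 \<longleftrightarrow>
      int_eval x (mu_coeff r s d1 d2 d3 0 0) \<noteq> 0 \<and> x k \<noteq> 0" for k
    by (simp add: int_eval.h_mult int_eval_mvar)
  have "wclass weight x \<notin> wp_zeros ?I weight (base_change ` keller_nonvanishing r s d1 d2 d3) \<longleftrightarrow>
      (\<exists>f\<in>keller_nonvanishing r s d1 d2 d3. int_eval x f \<noteq> 0)"
    unfolding wp_zeros_iff[OF base_change_whom[OF keller_nonvanishing_whom] x] int_eval_def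
    by blast
  also have "\<dots> \<longleftrightarrow> int_eval x (mu_coeff r s d1 d2 d3 0 0) \<noteq> 0 \<and>
      (\<exists>i j. i + j \<ge> 1 \<and> (In_L, i, j) \<in> coords r s d1 d2 d3 \<and> x (In_L, i, j) \<noteq> 0)"
    unfolding keller_nonvanishing_def using product by blast
  finally show ?thesis
    unfolding keller_conditions_def using eqs by blast
qed

lemma W_locus_zeros:
  "W_locus r s d1 d2 d3 =
    wp_zeros (coords r s d1 d2 d3) weight (base_change ` keller_equations r s d1 d2 d3) -
    wp_zeros (coords r s d1 d2 d3) weight (base_change ` keller_nonvanishing r s d1 d2 d3)"
    (is "_ = ?Z")
proof -
  have "P \<in> W_locus r s d1 d2 d3 \<longleftrightarrow> P \<in> ?Z" if P: "P \<in> WP (coords r s d1 d2 d3) weight" for P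
  proof -
    have all: "P \<in> ?Z \<longleftrightarrow> keller_conditions r s d1 d2 d3 x" if "x \<in> P" for x
      using mem_WP_elim[OF P that] keller_conditions_zeros by simp
    obtain x where "x \<in> P" using P wclass_self by (fastforce simp: WP_punctured)
    moreover have "P \<in> W_locus r s d1 d2 d3 \<longleftrightarrow> (\<forall>x\<in>P. keller_conditions r s d1 d2 d3 x)"
      using P by (simp only: W_locus_def keller_conditions_def int_eval_def mem_Collect_eq simp_thms)
    ultimately show ?thesis using all by blast
  qed
  moreover have "W_locus r s d1 d2 d3 \<subseteq> WP (coords r s d1 d2 d3) weight"
    "?Z \<subseteq> WP (coords r s d1 d2 d3) weight"
    by (auto simp: W_locus_def wp_zeros_def)
  ultimately show ?thesis by blast
qed

lemma W_locus_iff: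
  "x \<in> punctured (coords r s d1 d2 d3) \<Longrightarrow>
    wclass weight x \<in> W_locus r s d1 d2 d3 \<longleftrightarrow> keller_conditions r s d1 d2 d3 x"
  unfolding W_locus_zeros by (rule keller_conditions_zeros)

lemma W_locus_defined_over_Z: "wp_defined_over_Z (coords r s d1 d2 d3) weight (W_locus r s d1 d2 d3)"
  unfolding wp_defined_over_Z_def
  by (rule exI, rule exI, intro conjI, rule finite_keller_equations,
      rule finite_keller_nonvanishing, rule keller_equations_whom,
      rule keller_nonvanishing_whom, rule W_locus_zeros)

lemma W_locus_locally_closed:
  "locally_closed_in (wp_topology (coords r s d1 d2 d3) weight) (W_locus r s d1 d2 d3)"
proof -
  let ?I = "coords r s d1 d2 d3"
  let ?E = "base_change ` keller_equations r s d1 d2 d3 :: (coord, complex) mpoly set"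
  let ?N = "base_change ` keller_nonvanishing r s d1 d2 d3 :: (coord, complex) mpoly set"
  have open_complement: "openin (wp_topology ?I weight) (WP ?I weight - wp_zeros ?I weight S)"
    if "S \<subseteq> whom_polys ?I weight" for S
    unfolding openin_wp using that by blast
  have "closedin (wp_topology ?I weight) (wp_zeros ?I weight ?E)"
    unfolding closedin_def topspace_wp
    using open_complement[OF base_change_whom[OF keller_equations_whom]]
    by (auto simp: wp_zeros_def)
  moreover have "openin (wp_topology ?I weight) (WP ?I weight - wp_zeros ?I weight ?N)"
    by (rule open_complement[OF base_change_whom[OF keller_nonvanishing_whom]])
  moreover have "W_locus r s d1 d2 d3 = wp_zeros ?I weight ?E \<inter> (WP ?I weight - wp_zeros ?I weight ?N)"
    unfolding W_locus_zeros by (auto simp: wp_zeros_def)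
  ultimately show ?thesis unfolding locally_closed_in_def by blast
qed

text \<open>By \<open>lookup_mu\<close> the conditions on the \<open>mu_ij\<close> say that \<open>mu\<close> of the triple is a nonzero constant,
  and a nonzero coordinate of positive degree in \<open>\<Lambda>\<close> says that \<open>\<Lambda>\<close> is not constant.\<close>

lemma keller_triples_iff:
  "T \<in> keller_triples r s d1 d2 d3 \<longleftrightarrow>
    T \<in> triples r s d1 d2 d3 \<and> keller_conditions r s d1 d2 d3 (coord_vec T)"
proof -
  obtain A B L where T: "T = (A, B, L)" using prod_cases3 by metis
  have const: "(\<exists>c. c \<noteq> 0 \<and> p = bmonom 0 0 c) \<longleftrightarrow>
      (\<forall>i j. (i, j) \<noteq> (0, 0) \<longrightarrow> Poly_Mapping.lookup p (i, j) = 0) \<and> Poly_Mapping.lookup p (0, 0) \<noteq> 0"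
    for p :: "complex bpoly"
  proof
    assume p: "(\<forall>i j. (i, j) \<noteq> (0, 0) \<longrightarrow> Poly_Mapping.lookup p (i, j) = 0) \<and> Poly_Mapping.lookup p (0, 0) \<noteq> 0"
    have "p = bmonom 0 0 (Poly_Mapping.lookup p (0, 0))"
    proof (rule poly_mapping_eqI)
      fix k :: "nat \<times> nat"
      obtain i j where "k = (i, j)" by (rule prod.exhaust)
      then show "Poly_Mapping.lookup p k =
          Poly_Mapping.lookup (bmonom 0 0 (Poly_Mapping.lookup p (0, 0))) k"
        using p by (cases "(i, j) = (0, 0)") (auto simp: lookup_single when_def)
    qed
    then show "\<exists>c. c \<noteq> 0 \<and> p = bmonom 0 0 c" using p by blast
  qed (auto simp: lookup_single when_def)
  have deg: "total_degree L \<ge> 1 \<longleftrightarrow> (\<exists>i j. i + j \<ge> 1 \<and> Poly_Mapping.lookup L (i, j) \<noteq> 0)"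
  proof -
    have "total_degree L \<ge> 1 \<longleftrightarrow> \<not> total_degree L \<le> 0" by linarith
    also have "\<dots> \<longleftrightarrow> (\<exists>i j. Poly_Mapping.lookup L (i, j) \<noteq> 0 \<and> \<not> i + j \<le> 0)"
      unfolding total_degree_le by (simp add: Ball_def in_keys_iff split_paired_All)
    also have "\<dots> \<longleftrightarrow> (\<exists>i j. i + j \<ge> 1 \<and> Poly_Mapping.lookup L (i, j) \<noteq> 0)"
      by (intro ex_cong1) linarith
    finally show ?thesis .
  qed
  show ?thesis
  proof (cases "T \<in> triples r s d1 d2 d3")
    case True
    have L: "(In_L, i, j) \<in> coords r s d1 d2 d3" if "Poly_Mapping.lookup L (i, j) \<noteq> 0" for i j
      using True that by (auto simp: T mem_triples exponents_def in_keys_iff subset_iff)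
    have "T \<in> keller_triples r s d1 d2 d3 \<longleftrightarrow>
        total_degree L \<ge> 1 \<and> (\<exists>c. c \<noteq> 0 \<and> mu r s A B L = bmonom 0 0 c)"
      using True by (simp add: keller_triples_def T)
    then show ?thesis
      unfolding const deg keller_conditions_def
      using True L lookup_mu[of A B L r s d1 d2 d3] unfolding T coord_vec_simps by auto
  qed (simp add: keller_triples_def T)
qed

lemma keller_triples_punctured: "keller_triples r s d1 d2 d3 \<subseteq> punctured_triples r s d1 d2 d3"
  by (auto simp: keller_triples_def punctured_triples_def total_degree_def)

lemma orbits_bij_W_locus:
  "bij_betw (\<lambda>Orb. coord_vec ` Orb) (gm_orbit ` keller_triples r s d1 d2 d3) (W_locus r s d1 d2 d3)"
  unfolding bij_betw_def
proof
  show "inj_on (\<lambda>Orb. coord_vec ` Orb) (gm_orbit ` keller_triples r s d1 d2 d3)"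
    by (auto simp: inj_on_def coord_vec_orbit_eq_iff)
  have "(\<lambda>Orb. coord_vec ` Orb) ` gm_orbit ` keller_triples r s d1 d2 d3 =
      (\<lambda>T. wclass weight (coord_vec T)) ` keller_triples r s d1 d2 d3"
    unfolding image_image coord_vec_orbit ..
  also have "\<dots> = W_locus r s d1 d2 d3"
  proof (intro equalityI subsetI)
    fix P assume "P \<in> (\<lambda>T. wclass weight (coord_vec T)) ` keller_triples r s d1 d2 d3"
    then obtain T where T: "T \<in> keller_triples r s d1 d2 d3" "P = wclass weight (coord_vec T)" by blast
    then have "coord_vec T \<in> punctured (coords r s d1 d2 d3)"
      using keller_triples_punctured coord_vec_punctured by blast
    then show "P \<in> W_locus r s d1 d2 d3"
      using T W_locus_iff keller_triples_iff by simp
  next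
    fix P assume P: "P \<in> W_locus r s d1 d2 d3"
    then have "P \<in> WP (coords r s d1 d2 d3) weight" by (simp add: W_locus_def)
    then obtain T where T: "T \<in> punctured_triples r s d1 d2 d3" "P = wclass weight (coord_vec T)"
      unfolding WP_punctured coord_vec_image_punctured[symmetric] by blast
    then have "keller_conditions r s d1 d2 d3 (coord_vec T)"
      using P W_locus_iff coord_vec_punctured by blast
    then have "T \<in> keller_triples r s d1 d2 d3"
      using T(1) by (simp add: keller_triples_iff punctured_triples_def)
    then show "P \<in> (\<lambda>T. wclass weight (coord_vec T)) ` keller_triples r s d1 d2 d3"
      using T(2) by blast
  qed
  finally show "(\<lambda>Orb. coord_vec ` Orb) ` gm_orbit ` keller_triples r s d1 d2 d3 = W_locus r s d1 d2 d3" .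
qed

section \<open>A graded map determines its triple\<close>

definition bpoly_fun :: "complex bpoly \<Rightarrow> complex \<Rightarrow> complex \<Rightarrow> complex" where
  "bpoly_fun p y z = (\<Sum>(i, j)\<in>Poly_Mapping.keys p. Poly_Mapping.lookup p (i, j) * y ^ i * z ^ j)"

lemma bpoly_fun_square:
  assumes "total_degree p \<le> D"
  shows "bpoly_fun p y z = (\<Sum>i\<le>D. (\<Sum>j\<le>D. Poly_Mapping.lookup p (i, j) * z ^ j) * y ^ i)"
proof -
  have keys: "Poly_Mapping.keys p \<subseteq> {..D} \<times> {..D}"
    using assms unfolding total_degree_le by fastforce
  have "bpoly_fun p y z = (\<Sum>(i, j)\<in>{..D} \<times> {..D}. Poly_Mapping.lookup p (i, j) * y ^ i * z ^ j)"
    unfolding bpoly_fun_def using keys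
    by (intro sum.mono_neutral_left) (auto simp: in_keys_iff)
  also have "\<dots> = (\<Sum>i\<le>D. \<Sum>j\<le>D. Poly_Mapping.lookup p (i, j) * y ^ i * z ^ j)"
    by (simp add: sum.cartesian_product)
  finally show ?thesis by (simp add: sum_distrib_right sum_distrib_left mult_ac)
qed

text \<open>A polynomial in two variables is a polynomial in \<open>y\<close> whose coefficients are polynomials in
  \<open>z\<close>, so comparing coefficients twice recovers it from its values.\<close>

lemma bpoly_fun_inj:
  assumes "\<And>y z. bpoly_fun p y z = bpoly_fun q y z"
  shows "p = q"
proof -
  let ?D = "max (total_degree p) (total_degree q)"
  have "(\<Sum>j\<le>?D. Poly_Mapping.lookup p (i, j) * z ^ j) = (\<Sum>j\<le>?D. Poly_Mapping.lookup q (i, j) * z ^ j)"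
    if "i \<le> ?D" for i z
    using assms that
      polyfun_eq_coeffs[of "\<lambda>i. \<Sum>j\<le>?D. Poly_Mapping.lookup p (i, j) * z ^ j" ?D
        "\<lambda>i. \<Sum>j\<le>?D. Poly_Mapping.lookup q (i, j) * z ^ j"]
    by (simp add: bpoly_fun_square[of p ?D] bpoly_fun_square[of q ?D])
  then have eq: "Poly_Mapping.lookup p (i, j) = Poly_Mapping.lookup q (i, j)" if "i \<le> ?D" "j \<le> ?D" for i j
    using that polyfun_eq_coeffs[of "\<lambda>j. Poly_Mapping.lookup p (i, j)" ?D
        "\<lambda>j. Poly_Mapping.lookup q (i, j)"] by blast
  have zero: "Poly_Mapping.lookup f (i, j) = 0" if "f \<in> {p, q}" "\<not> (i \<le> ?D \<and> j \<le> ?D)" for f i j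
  proof (rule ccontr)
    assume "Poly_Mapping.lookup f (i, j) \<noteq> 0"
    then have "i + j \<le> total_degree f"
      using total_degree_le[of f "total_degree f"] by (auto simp: in_keys_iff)
    then show False using that by auto
  qed
  show ?thesis
  proof (rule poly_mapping_eqI)
    fix k :: "nat \<times> nat"
    obtain i j where k: "k = (i, j)" by (rule prod.exhaust)
    show "Poly_Mapping.lookup p k = Poly_Mapping.lookup q k"
      using eq[of i j] zero[of p i j] zero[of q i j] unfolding k by (cases "i \<le> ?D \<and> j \<le> ?D") auto
  qed
qed

text \<open>On the plane \<open>x = 1\<close> one has \<open>u = y\<close> and \<open>v = z\<close>, and the map restricts to the polynomial
  functions \<open>A\<close>, \<open>B\<close> and \<open>\<Lambda>\<close> themselves.\<close>

lemma graded_map_slice: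
  "graded_map r s (A, B, L) (1, y, z) = (bpoly_fun A y z, bpoly_fun B y z, bpoly_fun L y z)"
  by (simp add: graded_map_def bpoly_fun_def)

lemma inj_graded_map: "inj (graded_map r s)"
proof (rule injI)
  fix T T' assume eq: "graded_map r s T = graded_map r s T'"
  obtain A B L A' B' L' where T: "T = (A, B, L)" "T' = (A', B', L')"
    using prod_cases3 by metis
  have "graded_map r s (A, B, L) (1, y, z) = graded_map r s (A', B', L') (1, y, z)" for y z
    using eq by (simp add: T)
  then show "T = T'" by (auto simp: T graded_map_slice intro!: bpoly_fun_inj)
qed

section \<open>Parametrisation of graded Keller maps\<close>

theorem proposition8p14:
  fixes r s d1 d2 d3 N :: nat
  assumes r_pos: "r > 0" and s_pos: "s > 0"
    and N_def: "N = bpoly.dim (V_A_deg r s d1) + bpoly.dim (V_B_deg r s d2) + bpoly.dim (V_L_deg d3)"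
  shows "
    (finite (coords r s d1 d2 d3)) \<and>
    (card (coords r s d1 d2 d3) = N) \<and>
    (\<forall>k\<in>coords r s d1 d2 d3. weight k > 0) \<and>
    (variety_iso
           (quotient_topology (punctured_topology r s d1 d2 d3) gm_orbit)
           (quotient_regular (punctured_topology r s d1 d2 d3) (punctured_regular r s d1 d2 d3) gm_orbit)
           (wp_topology (coords r s d1 d2 d3) weight)
           (wp_regular (coords r s d1 d2 d3) weight)
           (\<lambda>Orb. coord_vec ` Orb)) \<and>
    (topspace (punctured_topology r s d1 d2 d3) = punctured_triples r s d1 d2 d3) \<and>
    (topspace (wp_topology (coords r s d1 d2 d3) weight) = WP (coords r s d1 d2 d3) weight) \<and>
    (d1 \<ge> 2 \<and> d3 \<ge> 1 \<longrightarrow> well_formed_weights (coords r s d1 d2 d3) weight) \<and>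
    (\<forall>i j. mu_coeff r s d1 d2 d3 i j \<in> polys_in (coords r s d1 d2 d3) \<and>
               whomogeneous weight (5 + i + j) (mu_coeff r s d1 d2 d3 i j)) \<and>
    (\<forall>(A, B, L)\<in>triples r s d1 d2 d3. \<forall>i j.
           Poly_Mapping.lookup (mu r s A B L) (i, j) =
           mpoly_eval (base_change (mu_coeff r s d1 d2 d3 i j)) (coord_vec (A, B, L))) \<and>
    (locally_closed_in (wp_topology (coords r s d1 d2 d3) weight) (W_locus r s d1 d2 d3)) \<and>
    (wp_defined_over_Z (coords r s d1 d2 d3) weight (W_locus r s d1 d2 d3)) \<and>
    (bij_betw (graded_map r s) (keller_triples r s d1 d2 d3) (keller_maps r s d1 d2 d3)) \<and>
    (keller_triples r s d1 d2 d3 \<subseteq> punctured_triples r s d1 d2 d3) \<and>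
    (bij_betw (\<lambda>Orb. coord_vec ` Orb)
           (gm_orbit ` keller_triples r s d1 d2 d3) (W_locus r s d1 d2 d3))"
proof (intro conjI)
  show "\<forall>k\<in>coords r s d1 d2 d3. weight k > 0"
    by (auto simp: weight_def)
  show "\<forall>i j. mu_coeff r s d1 d2 d3 i j \<in> polys_in (coords r s d1 d2 d3) \<and>
      whomogeneous weight (5 + i + j) (mu_coeff r s d1 d2 d3 i j)"
    using mu_coeff_hom by (auto simp: hom_polys_def)
  show "\<forall>(A, B, L)\<in>triples r s d1 d2 d3. \<forall>i j. Poly_Mapping.lookup (mu r s A B L) (i, j) =
      mpoly_eval (base_change (mu_coeff r s d1 d2 d3 i j)) (coord_vec (A, B, L))"
    using lookup_mu by (auto simp: int_eval_def)
  show "bij_betw (graded_map r s) (keller_triples r s d1 d2 d3) (keller_maps r s d1 d2 d3)"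
    unfolding bij_betw_def keller_maps_def using inj_graded_map inj_on_subset by blast
qed (simp_all add: finite_coords card_coords N_def quotient_iso_WP topspace_punctured
    topspace_wp well_formed_coords W_locus_locally_closed W_locus_defined_over_Z
    keller_triples_punctured orbits_bij_W_locus)

end
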